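(* Let $m\ge1$ be a fixed integer. With probability one, there exists a unique random index $$R^{(m)}:=\arg\max_{r\ge1}Z_r^{(m)} .$$ Moreover, $R_n^{(m)}$ converges in distribution to $R^{(m)}$ as $n\to\infty$. The limiting distribution has full support on the positive integers. More precisely, if $q_r^{(m)}:=\mathbb P\bigl(R^{(m)}=r\bigr)$ for $r\ge1$, then $$q_r^{(m)}>0\quad\text{for every } r\ge1,\qquad \sum_{r=1}^\infty q_r^{(m)}=1 .$$
   Context: For $n\ge1$, let $X_1,\ldots,X_n$ be independent standard exponential (rate $1$) random variables with order statistics $X_{1:n}\le\cdots\le X_{n:n}$, and put $X_{0:n}:=0$. For a fixed integer $m\ge1$ and $n\ge m$, the $m$-spacings are $$S^{(m)}_{j,n}:=X_{j:n}-X_{j-m:n},\qquad j=m,\ldots,n.$$ Let $I_n^{(m)}:=\arg\max_{j=m,\ldots,n}S^{(m)}_{j,n}$ denote the almost surely unique position of the largest $m$-spacing, and put $R_n^{(m)}:=n-I_n^{(m)}+1$, which takes values in $\{1,\ldots,n-m+1\}$. Let $(Y_r)_{r\ge1}$ be a sequence of independent random variables such that $Y_r$ has the exponential distribution with rate $r$ (density $re^{-rt}$, $t>0$) for every $r\ge1$, and define $$Z_r^{(m)}:=\sum_{\ell=0}^{m-1}Y_{r+\ell},\qquad r\ge1.$$ Here $\arg\max_{r\ge 1} Z_r^{(m)}$ denotes the index at which $\sup_{r\ge1}Z_r^{(m)}$ is attained. *)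

theory Defs
  imports "HOL-Probability.Probability"
begin

text \<open>
  All functions here act on a single realisation, that is, on a sequence of reals indexed from 1.
  \<open>order_stat x n j\<close> is $x_{j:n}$, with the convention $x_{0:n} = 0$; it is meant for \<open>j \<le> n\<close>.
\<close>

definition order_stat :: "(nat \<Rightarrow> real) \<Rightarrow> nat \<Rightarrow> nat \<Rightarrow> real" where
  "order_stat x n j = (if j = 0 then 0 else sort (map x [1..<Suc n]) ! (j - 1))"

definition spacing :: "nat \<Rightarrow> (nat \<Rightarrow> real) \<Rightarrow> nat \<Rightarrow> nat \<Rightarrow> real" where
  "spacing m x n j = order_stat x n j - order_stat x n (j - m)"

text \<open>
  If several spacings are maximal (a null event for exponential samples), \<open>arg_max_on\<close> picks
  one of their positions, and the choice depends only on the set of these positions.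
\<close>

definition max_spacing_pos :: "nat \<Rightarrow> (nat \<Rightarrow> real) \<Rightarrow> nat \<Rightarrow> nat" where
  "max_spacing_pos m x n = arg_max_on (spacing m x n) {m..n}"

definition max_spacing_rank :: "nat \<Rightarrow> (nat \<Rightarrow> real) \<Rightarrow> nat \<Rightarrow> nat" where
  "max_spacing_rank m x n = n - max_spacing_pos m x n + 1"

definition window_sum :: "nat \<Rightarrow> (nat \<Rightarrow> real) \<Rightarrow> nat \<Rightarrow> real" where
  "window_sum m y r = (\<Sum>l<m. y (r + l))"

text \<open>
  The value 0, which is not an admissible index, marks the realisations without a unique maximiser.
  An unspecified choice on this null event could make \<open>limit_rank\<close> non-measurable.
\<close>

definition limit_rank :: "nat \<Rightarrow> (nat \<Rightarrow> real) \<Rightarrow> nat" where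
  "limit_rank m y =
     (if \<exists>!r. is_arg_max (window_sum m y) (\<lambda>r. r \<in> {1..}) r
      then arg_max_on (window_sum m y) {1..} else 0)"

end

theory Submission
  imports Defs
begin

text \<open>
  For the order statistics of \<open>n\<close> standard exponentials, the gaps between neighbours, read from the
  largest down, are distributed as \<open>Y 1, \<dots>, Y n\<close> (Renyi). Under this coupling the spacing at
  position \<open>n - r + 1\<close> is the window sum at \<open>r\<close>, so the rank \<open>R\<^sub>n\<close> for sample size \<open>n\<close> coincides
  with the limiting rank \<open>R\<close> whenever the latter is at most \<open>n - m + 1\<close>. Hence \<open>P(R \<in> A, R \<le> n - m + 1)\<close> is a
  lower bound for \<open>P(R\<^sub>n \<in> A)\<close>, for every set \<open>A\<close>; applying this to \<open>A\<close> and to its complement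
  squeezes the distribution functions, because \<open>P(R \<le> n - m + 1)\<close> tends to 1.

  The limiting maximiser exists because \<open>Y r\<close> tends to 0 almost surely by the Borel-Cantelli lemma,
  and it has full support because \<open>Y r, \<dots>, Y (r + m - 1)\<close> slightly above 1 and all other \<open>Y i\<close> at
  most 1/2 is an event of positive probability.
\<close>

subsection \<open>Spacings of exponential order statistics\<close>

text \<open>The gaps \<open>d\<close> are listed from the smallest observation upwards, the first
  one measured from 0. Restricting to \<open>{1..n}\<close> keeps the result extensional, hence a
  point of the product space.\<close>

definition cumul :: "nat \<Rightarrow> (nat \<Rightarrow> real) \<Rightarrow> nat \<Rightarrow> real" where
  "cumul n d = (\<lambda>i\<in>{1..n}. \<Sum>j\<in>{1..i}. d j)"

lemma measurable_cumul [measurable]: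
  "cumul n \<in> Pi\<^sub>M {1..n} (\<lambda>_. lborel) \<rightarrow>\<^sub>M Pi\<^sub>M {1..n} (\<lambda>_. lborel)"
proof -
  have "(\<lambda>d. \<Sum>j\<in>{1..i}. d j) \<in> Pi\<^sub>M {1..n} (\<lambda>_. lborel :: real measure) \<rightarrow>\<^sub>M lborel"
    if "i \<in> {1..n}" for i
  proof -
    have "(\<lambda>d. \<Sum>j\<in>{1..i}. d j) \<in> borel_measurable (Pi\<^sub>M {1..n} (\<lambda>_. lborel :: real measure))"
    proof (intro borel_measurable_sum)
      fix j assume "j \<in> {1..i}"
      then have "(\<lambda>d. d j) \<in> Pi\<^sub>M {1..n} (\<lambda>_. lborel :: real measure) \<rightarrow>\<^sub>M lborel"
        using that by (intro measurable_component_singleton) auto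
      then show "(\<lambda>d. d j) \<in> borel_measurable (Pi\<^sub>M {1..n} (\<lambda>_. lborel :: real measure))"
        by simp
    qed
    then show ?thesis by simp
  qed
  then show ?thesis
    unfolding cumul_def by (intro measurable_restrict)
qed

text \<open>The last gap enters only the last partial sum, which the earlier gaps merely translate.
  This drives the induction in \<open>nn_integral_cumul\<close>.\<close>

lemma cumul_Suc:
  "cumul (Suc n) (d(Suc n := t)) = (cumul n d)(Suc n := t + (\<Sum>j\<in>{1..n}. d j))"
proof
  fix i
  have "(\<Sum>j\<in>{1..i}. (d(Suc n := t)) j) = (\<Sum>j\<in>{1..i}. d j)" if "i \<le> n"
    using that by (intro sum.cong) auto
  moreover have "(\<Sum>j\<in>{1..Suc n}. (d(Suc n := t)) j) = t + (\<Sum>j\<in>{1..n}. d j)"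
  proof -
    have "(\<Sum>j\<in>{1..n}. (d(Suc n := t)) j) = (\<Sum>j\<in>{1..n}. d j)"
      by (intro sum.cong) auto
    then show ?thesis by simp
  qed
  ultimately show "cumul (Suc n) (d(Suc n := t)) i = ((cumul n d)(Suc n := t + (\<Sum>j\<in>{1..n}. d j))) i"
    by (cases "i = Suc n") (auto simp: cumul_def restrict_def le_Suc_eq)
qed

text \<open>The map is linear and triangular with unit diagonal, so it preserves Lebesgue measure.
  No determinant is computed: with the last coordinate integrated innermost, the map acts there as a
  translation of the line.\<close>

lemma nn_integral_cumul:
  assumes "f \<in> borel_measurable (Pi\<^sub>M {1..n} (\<lambda>_. lborel))"
  shows "(\<integral>\<^sup>+ x. f x \<partial>Pi\<^sub>M {1..n} (\<lambda>_. lborel)) = (\<integral>\<^sup>+ d. f (cumul n d) \<partial>Pi\<^sub>M {1..n} (\<lambda>_. lborel))"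
  using assms
proof (induction n arbitrary: f)
  case 0
  then show ?case by (simp add: PiM_empty nn_integral_count_space_finite cumul_def restrict_def)
next
  case (Suc n)
  interpret product_sigma_finite "\<lambda>_::nat. lborel :: real measure" by standard
  have I: "{1..Suc n} = insert (Suc n) {1..n}" by auto
  let ?P = "Pi\<^sub>M {1..n} (\<lambda>_. lborel :: real measure)"
  have f[measurable]: "f \<in> borel_measurable (Pi\<^sub>M (insert (Suc n) {1..n}) (\<lambda>_. lborel))"
    using Suc.prems unfolding I .
  have f': "(\<lambda>d. f (cumul (Suc n) d)) \<in> borel_measurable (Pi\<^sub>M (insert (Suc n) {1..n}) (\<lambda>_. lborel))"
    using measurable_compose[OF measurable_cumul Suc.prems] unfolding I .
  define g where "g x = (\<integral>\<^sup>+ t. f (x(Suc n := t)) \<partial>lborel)" for x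
  have g[measurable]: "g \<in> borel_measurable ?P"
    unfolding g_def by measurable
  have shift: "(\<integral>\<^sup>+ t. f (x(Suc n := t)) \<partial>lborel) = (\<integral>\<^sup>+ t. f (x(Suc n := t + c)) \<partial>lborel)"
    if "x \<in> space ?P" for x c
  proof -
    have "(\<lambda>t. x(Suc n := t)) \<in> lborel \<rightarrow>\<^sub>M Pi\<^sub>M (insert (Suc n) {1..n}) (\<lambda>_. lborel)"
      using that by (intro measurable_component_update) auto
    from measurable_compose[OF this f] 
    have "(\<lambda>t. f (x(Suc n := t))) \<in> borel_measurable borel" by simp
    from nn_integral_real_affine[OF this, of 1 c] show ?thesis
      by (simp add: add.commute)
  qed
  have "(\<integral>\<^sup>+ x. f x \<partial>Pi\<^sub>M {1..Suc n} (\<lambda>_. lborel)) = (\<integral>\<^sup>+ x. g x \<partial>?P)"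
    unfolding I g_def by (rule product_nn_integral_insert[OF _ _ f]) auto
  also have "\<dots> = (\<integral>\<^sup>+ d. g (cumul n d) \<partial>?P)"
    by (rule Suc.IH) measurable
  also have "\<dots> = (\<integral>\<^sup>+ d. (\<integral>\<^sup>+ t. f (cumul (Suc n) (d(Suc n := t))) \<partial>lborel) \<partial>?P)"
    unfolding g_def cumul_Suc
    by (intro nn_integral_cong shift measurable_space[OF measurable_cumul])
  also have "\<dots> = (\<integral>\<^sup>+ d. f (cumul (Suc n) d) \<partial>Pi\<^sub>M {1..Suc n} (\<lambda>_. lborel))"
    unfolding I by (rule product_nn_integral_insert[OF _ _ f', symmetric]) auto
  finally show ?case .
qed

text \<open>By Fubini both measures agree on boxes, and a finite product of sigma-finite measures is
  determined by its values on boxes.\<close>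

lemma density_PiM_lborel:
  fixes f :: "'i \<Rightarrow> real \<Rightarrow> real"
  assumes I: "finite I" and f: "\<And>i. f i \<in> borel_measurable borel"
  shows "Pi\<^sub>M I (\<lambda>i. density lborel (\<lambda>t. ennreal (f i t))) = density (Pi\<^sub>M I (\<lambda>_. lborel)) (\<lambda>x. \<Prod>i\<in>I. ennreal (f i (x i)))"
proof -
  interpret L: product_sigma_finite "\<lambda>_::'i. lborel :: real measure" by standard
  interpret D: product_sigma_finite "\<lambda>i. density lborel (\<lambda>t. ennreal (f i t))"
    unfolding product_sigma_finite_def using f
    by (simp add: sigma_finite_measure.sigma_finite_iff_density_finite[OF sigma_finite_lborel])
  have m: "(\<lambda>x. ennreal (f i (x i))) \<in> borel_measurable (Pi\<^sub>M I (\<lambda>_. lborel))" if "i \<in> I" for i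
    using that f by (intro measurable_compose[OF measurable_component_singleton, where g = "\<lambda>t. ennreal (f i t)"]) auto
  have m': "(\<lambda>x. \<Prod>i\<in>I. ennreal (f i (x i))) \<in> borel_measurable (Pi\<^sub>M I (\<lambda>_. lborel))"
    using m by (intro borel_measurable_prod_ennreal) auto
  show ?thesis
  proof (rule D.PiM_eqI[symmetric])
    show "sets (density (Pi\<^sub>M I (\<lambda>_. lborel)) (\<lambda>x. \<Prod>i\<in>I. ennreal (f i (x i)))) = sets (Pi\<^sub>M I (\<lambda>i. density lborel (\<lambda>t. ennreal (f i t))))"
      by (auto intro!: sets_PiM_cong)
  next
    fix A assume A: "\<And>i. i \<in> I \<Longrightarrow> A i \<in> sets (density lborel (\<lambda>t. ennreal (f i t)))"
    then have S: "Pi\<^sub>E I A \<in> sets (Pi\<^sub>M I (\<lambda>_. lborel))"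
      using I by (intro sets_PiM_I_finite) auto
    have "emeasure (density (Pi\<^sub>M I (\<lambda>_. lborel)) (\<lambda>x. \<Prod>i\<in>I. ennreal (f i (x i)))) (Pi\<^sub>E I A)
        = (\<integral>\<^sup>+ x. (\<Prod>i\<in>I. ennreal (f i (x i))) * indicator (Pi\<^sub>E I A) x \<partial>Pi\<^sub>M I (\<lambda>_. lborel))"
      using m' S by (rule emeasure_density)
    also have "\<dots> = (\<integral>\<^sup>+ x. (\<Prod>i\<in>I. ennreal (f i (x i)) * indicator (A i) (x i)) \<partial>Pi\<^sub>M I (\<lambda>_. lborel))"
    proof (rule nn_integral_cong)
      fix x :: "'i \<Rightarrow> real" assume "x \<in> space (Pi\<^sub>M I (\<lambda>_. lborel))"
      \<comment> \<open>Points of the space are extensional, so membership in the box depends on the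
        coordinates in \<open>I\<close> alone.\<close>
      then have "indicator (Pi\<^sub>E I A) x = (\<Prod>i\<in>I. indicator (A i) (x i) :: ennreal)"
        using I by (auto simp: indicator_def space_PiM PiE_iff prod_zero_iff)
      then show "(\<Prod>i\<in>I. ennreal (f i (x i))) * indicator (Pi\<^sub>E I A) x = (\<Prod>i\<in>I. ennreal (f i (x i)) * indicator (A i) (x i))"
        by (simp add: prod.distrib)
    qed
    also have "\<dots> = (\<Prod>i\<in>I. \<integral>\<^sup>+ t. ennreal (f i t) * indicator (A i) t \<partial>lborel)"
      using I f A by (intro L.product_nn_integral_prod) auto
    also have "\<dots> = (\<Prod>i\<in>I. emeasure (density lborel (\<lambda>t. ennreal (f i t))) (A i))"
      using f A by (intro prod.cong) (auto simp: emeasure_density)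
    finally show "emeasure (density (Pi\<^sub>M I (\<lambda>_. lborel)) (\<lambda>x. \<Prod>i\<in>I. ennreal (f i (x i)))) (Pi\<^sub>E I A)
        = (\<Prod>i\<in>I. emeasure (density lborel (\<lambda>t. ennreal (f i t))) (A i))" .
  qed (fact I)
qed

text \<open>The gap \<open>d j\<close> is counted once for each i from j to n, that is, n + 1 - j
  times. These multiplicities become the rates of the gaps.\<close>

lemma sum_cumul:
  "(\<Sum>i\<in>{1..n}. \<Sum>j\<in>{1..i}. d j) = (\<Sum>j\<in>{1..n}. real (Suc n - j) * d j)"
proof (induction n)
  case (Suc n)
  have "(\<Sum>j\<in>{1..Suc n}. real (Suc (Suc n) - j) * d j) = (\<Sum>j\<in>{1..Suc n}. real (Suc n - j) * d j + d j)"
    by (intro sum.cong) (auto simp: of_nat_diff algebra_simps)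
  then show ?case using Suc by (simp add: sum.distrib)
qed simp

section \<open>Exponential densities on the ordered region\<close>

abbreviation exp_law :: "real \<Rightarrow> real measure" where
  "exp_law l \<equiv> density lborel (exponential_density l)"

definition ordered :: "nat \<Rightarrow> (nat \<Rightarrow> real) set" where
  "ordered n = {x. (\<forall>i\<in>{1..n}. 0 < x i) \<and> (\<forall>i\<in>{1..n}. \<forall>j\<in>{1..n}. i < j \<longrightarrow> x i < x j)}"

lemma cumul_in_ordered: "cumul n d \<in> ordered n" if d: "\<forall>i\<in>{1..n}. 0 < d i"
proof -
  have "(\<Sum>k\<in>{1..i}. d k) < (\<Sum>k\<in>{1..j}. d k)" if "i < j" "j \<le> n" for i j
  proof -
    have "(\<Sum>k\<in>{1..j}. d k) = (\<Sum>k\<in>{1..i}. d k) + (\<Sum>k\<in>{Suc i..j}. d k)"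
      using that by (subst sum.union_disjoint[symmetric]) (auto intro!: sum.cong)
    moreover have "0 < (\<Sum>k\<in>{Suc i..j}. d k)"
      using d that by (intro sum_pos) auto
    ultimately show ?thesis by simp
  qed
  from this[of 0] this show ?thesis
    by (auto simp: ordered_def cumul_def)
qed

text \<open>The exponents combine by \<open>sum_cumul\<close>, and the factor n! supplies the
  normalising constants, being the product of the rates n, ..., 1.\<close>

lemma exponential_density_ordered:
  assumes d: "\<forall>i\<in>{1..n}. 0 < d i"
  shows "fact n * (\<Prod>i\<in>{1..n}. ennreal (exponential_density 1 (cumul n d i)))
       = (\<Prod>i\<in>{1..n}. ennreal (exponential_density (real (Suc n - i)) (d i)))"
proof -
  have pos: "0 < cumul n d i" if "i \<in> {1..n}" for i
    using cumul_in_ordered[OF d] that by (auto simp: ordered_def)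
  have "fact n * (\<Prod>i\<in>{1..n}. exponential_density 1 (cumul n d i))
     = fact n * (\<Prod>i\<in>{1..n}. exp (- cumul n d i))"
    using pos by (intro arg_cong2[where f = "(*)"] prod.cong refl)
      (force simp: exponential_density_def dest: less_imp_le)
  also have "\<dots> = fact n * exp (- (\<Sum>i\<in>{1..n}. cumul n d i))"
    by (simp add: exp_sum sum_negf[symmetric])
  also have "(\<Sum>i\<in>{1..n}. cumul n d i) = (\<Sum>j\<in>{1..n}. real (Suc n - j) * d j)"
    unfolding sum_cumul[symmetric] by (intro sum.cong) (auto simp: cumul_def)
  also have "fact n * exp (- (\<Sum>j\<in>{1..n}. real (Suc n - j) * d j))
     = (\<Prod>i\<in>{1..n}. real (Suc n - i)) * (\<Prod>i\<in>{1..n}. exp (- (real (Suc n - i) * d i)))"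
  proof -
    have "fact n = (\<Prod>i\<in>{1..n}. real (Suc n - i))"
      using prod.atLeastAtMost_rev[of real 1 n] by (simp add: fact_prod)
    then show ?thesis by (simp add: exp_sum sum_negf[symmetric])
  qed
  also have "\<dots> = (\<Prod>i\<in>{1..n}. exponential_density (real (Suc n - i)) (d i))"
    unfolding prod.distrib[symmetric]
  proof (intro prod.cong refl)
    fix i assume "i \<in> {1..n}"
    then have "\<not> d i < 0" using d by force
    then show "real (Suc n - i) * exp (- (real (Suc n - i) * d i)) = exponential_density (real (Suc n - i)) (d i)"
      by (simp add: exponential_density_def mult.commute)
  qed
  finally have "ennreal (fact n * (\<Prod>i\<in>{1..n}. exponential_density 1 (cumul n d i)))
     = ennreal (\<Prod>i\<in>{1..n}. exponential_density (real (Suc n - i)) (d i))" by simp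
  moreover have "(\<Prod>i\<in>{1..n}. ennreal (exponential_density 1 (cumul n d i)))
      = ennreal (\<Prod>i\<in>{1..n}. exponential_density 1 (cumul n d i))"
    by (rule prod_ennreal) simp
  moreover have "(\<Prod>i\<in>{1..n}. ennreal (exponential_density (real (Suc n - i)) (d i)))
      = ennreal (\<Prod>i\<in>{1..n}. exponential_density (real (Suc n - i)) (d i))"
    by (rule prod_ennreal) (rule erlang_density_nonneg, simp)
  moreover have "(fact n :: ennreal) = ennreal (fact n)"
    by (metis ennreal_of_nat_eq_real_of_nat of_nat_fact)
  ultimately show ?thesis
    by (simp only: ennreal_mult''[symmetric] prod_nonneg erlang_density_nonneg zero_le_one)
qed

text \<open>Both permutations list the same set of values in strictly increasing order, and such a
  list is determined by its set. Since the n values are distinct, equal values come from equal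
  indices.\<close>

lemma ordered_permutation_unique:
  assumes x: "(\<lambda>i\<in>{1..n}. x (p i)) \<in> ordered n" "(\<lambda>i\<in>{1..n}. x (q i)) \<in> ordered n"
    and p: "p permutes {1..n}" and q: "q permutes {1..n}"
  shows "p = q"
proof -
  have sorted: "sorted (map (\<lambda>i. x (r i)) [1..<Suc n]) \<and> distinct (map (\<lambda>i. x (r i)) [1..<Suc n])
      \<and> set (map (\<lambda>i. x (r i)) [1..<Suc n]) = x ` {1..n}"
    if "(\<lambda>i\<in>{1..n}. x (r i)) \<in> ordered n" "r permutes {1..n}" for r
  proof -
    have lt: "x (r i) < x (r j)" if "i \<in> {1..n}" "j \<in> {1..n}" "i < j" for i j
      using \<open>(\<lambda>i\<in>{1..n}. x (r i)) \<in> ordered n\<close> that unfolding ordered_def by force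
    have "sorted_wrt (<) (map (\<lambda>i. x (r i)) [1..<Suc n])"
      using lt by (subst sorted_wrt_map, rule sorted_wrt_mono_rel[of _ "(<)"])
        (auto simp: sorted_wrt_upt simp del: upt_Suc)
    moreover have "set (map (\<lambda>i. x (r i)) [1..<Suc n]) = x ` (r ` {1..n})"
      by (auto simp: image_image simp del: upt_Suc)
    ultimately show ?thesis
      using permutes_image[OF that(2)] by (simp add: strict_sorted_iff del: upt_Suc)
  qed
  have eq: "map (\<lambda>i. x (p i)) [1..<Suc n] = map (\<lambda>i. x (q i)) [1..<Suc n]"
    using sorted[OF x(1) p] sorted[OF x(2) q] by (intro sorted_distinct_set_unique) auto
  have "inj_on x {1..n}"
  proof (rule eq_card_imp_inj_on)
    show "card (x ` {1..n}) = card {1..n}"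
      using sorted[OF x(1) p] distinct_card[of "map (\<lambda>i. x (p i)) [1..<Suc n]"] by (simp del: upt_Suc set_map)
  qed simp
  moreover have "x (p i) = x (q i)" "p i \<in> {1..n}" "q i \<in> {1..n}" if "i \<in> {1..n}" for i
    using eq that permutes_in_image[OF p] permutes_in_image[OF q]
    by (auto simp: map_eq_conv simp del: upt_Suc)
  ultimately have "p i = q i" if "i \<in> {1..n}" for i
    using that by (meson inj_onD)
  then show ?thesis
    using permutes_not_in[OF p] permutes_not_in[OF q] by (metis ext)
qed

lemma sets_ordered: "{x \<in> space (Pi\<^sub>M {1..n} (\<lambda>_. lborel)). x \<in> ordered n} \<in> sets (Pi\<^sub>M {1..n} (\<lambda>_. lborel))"
proof -
  have m: "(\<lambda>x. x i) \<in> borel_measurable (Pi\<^sub>M {1..n} (\<lambda>_. lborel :: real measure))"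
    if "i \<in> {1..n}" for i
    using measurable_component_singleton[OF that, of "\<lambda>_. lborel :: real measure"] by simp
  show ?thesis unfolding ordered_def mem_Collect_eq
    by (intro sets.sets_Collect_conj sets.sets_Collect_finite_All sets.sets_Collect_imp
        borel_measurable_less m borel_measurable_const sets.sets_Collect_const finite_atLeastAtMost)
      auto
qed

lemma sets_positive_cumul:
  assumes S: "S \<in> sets (Pi\<^sub>M {1..n} (\<lambda>_. lborel))"
  shows "{d \<in> space (Pi\<^sub>M {1..n} (\<lambda>_. lborel)). (\<forall>i\<in>{1..n}. 0 < d i) \<and> cumul n d \<in> S}
    \<in> sets (Pi\<^sub>M {1..n} (\<lambda>_. lborel))"
proof -
  let ?L = "Pi\<^sub>M {1..n} (\<lambda>_. lborel :: real measure)"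
  have m: "(\<lambda>x. x i) \<in> borel_measurable ?L" if "i \<in> {1..n}" for i
    using measurable_component_singleton[OF that, of "\<lambda>_. lborel :: real measure"] by simp
  have "{d \<in> space ?L. cumul n d \<in> S} = cumul n -` S \<inter> space ?L" by auto
  then have cS: "{d \<in> space ?L. cumul n d \<in> S} \<in> sets ?L"
    using measurable_sets[OF measurable_cumul S] by simp
  show ?thesis
    by (intro sets.sets_Collect_conj sets.sets_Collect_finite_All borel_measurable_less m
        borel_measurable_const finite_atLeastAtMost cS) (use cS in auto)
qed

text \<open>
  The substitution \<open>x = cumul n d\<close> preserves Lebesgue measure and turns the density of the sample,
  times \<open>n!\<close>, into the joint density of the gaps.
\<close>

lemma emeasure_ordered_exponential:
  assumes S: "S \<in> sets (Pi\<^sub>M {1..n} (\<lambda>_. lborel))"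
  shows "emeasure (Pi\<^sub>M {1..n} (\<lambda>i. exp_law (real (Suc n - i))))
      {d \<in> space (Pi\<^sub>M {1..n} (\<lambda>_. lborel)). (\<forall>i\<in>{1..n}. 0 < d i) \<and> cumul n d \<in> S}
    \<le> fact n * emeasure (Pi\<^sub>M {1..n} (\<lambda>_. exp_law 1)) (S \<inter> {x. x \<in> ordered n})"
proof -
  let ?L = "Pi\<^sub>M {1..n} (\<lambda>_. lborel :: real measure)"
  define D where "D = {d \<in> space ?L. (\<forall>i\<in>{1..n}. 0 < d i) \<and> cumul n d \<in> S}"
  define C where "C = S \<inter> {x. x \<in> ordered n}"
  have "C = S \<inter> {x \<in> space ?L. x \<in> ordered n}"
    using sets.sets_into_space[OF S] by (auto simp: C_def)
  then have C[measurable]: "C \<in> sets ?L" using S sets_ordered by auto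
  have m: "(\<lambda>x. x i) \<in> borel_measurable ?L" if "i \<in> {1..n}" for i
    using measurable_component_singleton[OF that, of "\<lambda>_. lborel :: real measure"] by simp
  have D: "D \<in> sets ?L" unfolding D_def by (rule sets_positive_cumul[OF S])
  define e where "e l = (\<lambda>x. \<Prod>i\<in>{1..n}. ennreal (exponential_density (l i) (x i)))" for l
  have e[measurable]: "e l \<in> borel_measurable ?L" for l
    unfolding e_def by (intro borel_measurable_prod_ennreal measurable_compose[OF m]) auto
  have law: "Pi\<^sub>M {1..n} (\<lambda>i. exp_law (l i)) = density ?L (e l)" for l
    unfolding e_def by (rule density_PiM_lborel) auto
  have "emeasure (Pi\<^sub>M {1..n} (\<lambda>i. exp_law (real (Suc n - i)))) D
      = (\<integral>\<^sup>+ d. e (\<lambda>i. real (Suc n - i)) d * indicator D d \<partial>?L)"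
    unfolding law by (rule emeasure_density[OF e D])
  \<comment> \<open>On \<open>D\<close> the point \<open>cumul n d\<close> lies in \<open>C\<close>
    and both sides agree; off \<open>D\<close> the left side is 0.\<close>
  also have "\<dots> \<le> (\<integral>\<^sup>+ d. fact n * (e (\<lambda>_. 1) (cumul n d) * indicator C (cumul n d)) \<partial>?L)"
  proof (rule nn_integral_mono)
    fix d
    show "e (\<lambda>i. real (Suc n - i)) d * indicator D d
        \<le> fact n * (e (\<lambda>_. 1) (cumul n d) * indicator C (cumul n d))"
      using exponential_density_ordered[of n d] cumul_in_ordered[of n d]
      unfolding e_def D_def C_def by (auto simp: indicator_def simp del: One_nat_def of_nat_diff of_nat_Suc)
  qed
  also have "\<dots> = fact n * (\<integral>\<^sup>+ d. e (\<lambda>_. 1) (cumul n d) * indicator C (cumul n d) \<partial>?L)"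
    by (rule nn_integral_cmult) measurable
  also have "\<dots> = fact n * (\<integral>\<^sup>+ x. e (\<lambda>_. 1) x * indicator C x \<partial>?L)"
    by (subst nn_integral_cumul[of "\<lambda>x. e (\<lambda>_. 1) x * indicator C x"]) 
      (intro borel_measurable_times_ennreal borel_measurable_indicator e C, rule refl)
  also have "\<dots> = fact n * emeasure (Pi\<^sub>M {1..n} (\<lambda>_. exp_law 1)) C"
    unfolding law by (subst emeasure_density[OF e C]) rule
  finally show ?thesis unfolding D_def C_def .
qed

text \<open>The \<open>n!\<close> permuted copies of the ordered region are disjoint and equally likely.\<close>

lemma exponential_order_spacings_le:
  assumes S: "S \<in> sets (Pi\<^sub>M {1..n} (\<lambda>_. lborel))"
    and sym: "\<And>x p. p permutes {1..n} \<Longrightarrow> x \<in> space (Pi\<^sub>M {1..n} (\<lambda>_. lborel :: real measure)) \<Longrightarrow> 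
       (\<lambda>i\<in>{1..n}. x (p i)) \<in> S \<Longrightarrow> x \<in> S"
  shows "emeasure (Pi\<^sub>M {1..n} (\<lambda>i. exp_law (real (Suc n - i))))
      {d \<in> space (Pi\<^sub>M {1..n} (\<lambda>_. lborel)). (\<forall>i\<in>{1..n}. 0 < d i) \<and> cumul n d \<in> S}
    \<le> emeasure (Pi\<^sub>M {1..n} (\<lambda>_. exp_law 1)) S"
proof -
  let ?L = "Pi\<^sub>M {1..n} (\<lambda>_. lborel :: real measure)"
  let ?P = "Pi\<^sub>M {1..n} (\<lambda>_. exp_law 1)"
  have sP: "sets ?P = sets ?L" by (intro sets_PiM_cong) auto
  have spP: "space ?P = space ?L" using sets_eq_imp_space_eq[OF sP] .
  define C where "C = S \<inter> {x. x \<in> ordered n}"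
  have "C = S \<inter> {x \<in> space ?L. x \<in> ordered n}"
    using sets.sets_into_space[OF S] by (auto simp: C_def)
  then have C: "C \<in> sets ?P" using S sets_ordered sP by auto
  define T where "T p = (\<lambda>x. \<lambda>i\<in>{1..n}. x (p i) :: real)" for p :: "nat \<Rightarrow> nat"
  define B where "B p = T p -` C \<inter> space ?P" for p
  have T: "T p \<in> ?P \<rightarrow>\<^sub>M ?P" "emeasure ?P (B p) = emeasure ?P C" if p: "p permutes {1..n}" for p
  proof -
    \<comment> \<open>All coordinates have the same law, so permuting them preserves the product
      measure.\<close>
    have D: "distr ?P ?P (T p) = ?P" unfolding T_def
      using permutes_inj_on[OF p] permutes_in_image[OF p]
      by (intro distr_PiM_reindex[where M = "\<lambda>_. exp_law 1"] prob_space_exponential_density) auto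
    show M: "T p \<in> ?P \<rightarrow>\<^sub>M ?P" unfolding T_def
      using permutes_in_image[OF p] by (intro measurable_restrict measurable_component_singleton) auto
    show "emeasure ?P (B p) = emeasure ?P C"
      unfolding B_def using emeasure_distr[OF M C] D by simp
  qed
  let ?F = "{p. p permutes {1..n}}"
  have "emeasure (Pi\<^sub>M {1..n} (\<lambda>i. exp_law (real (Suc n - i))))
      {d \<in> space ?L. (\<forall>i\<in>{1..n}. 0 < d i) \<and> cumul n d \<in> S} \<le> fact n * emeasure ?P C"
    unfolding C_def by (rule emeasure_ordered_exponential[OF S])
  also have "\<dots> = (\<Sum>p\<in>?F. emeasure ?P (B p))"
    using T(2) by (simp add: card_permutations[OF refl])
  also have "\<dots> = emeasure ?P (\<Union>p\<in>?F. B p)"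
  proof (rule sum_emeasure)
    show "B ` ?F \<subseteq> sets ?P" 
      using T(1) C unfolding B_def by (auto intro: measurable_sets)
    show "finite ?F" by (simp add: finite_permutations)
    show "disjoint_family_on B ?F"
    proof (unfold disjoint_family_on_def, intro ballI impI)
      fix p q assume pq: "p \<in> ?F" "q \<in> ?F" "p \<noteq> q"
      show "B p \<inter> B q = {}"
      proof (rule ccontr)
        assume "B p \<inter> B q \<noteq> {}"
        then obtain x where "T p x \<in> ordered n" "T q x \<in> ordered n"
          by (auto simp: B_def C_def)
        then show False
          using ordered_permutation_unique[where n = n and x = x and p = p and q = q] pq by (simp add: T_def)
      qed
    qed
  qed
  \<comment> \<open>By \<open>sym\<close> every permuted copy of \<open>C\<close> stays inside
    \<open>S\<close>.\<close>
  also have "\<dots> \<le> emeasure ?P S"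
  proof (rule emeasure_mono)
    show "(\<Union>p\<in>?F. B p) \<subseteq> S"
      using sym unfolding B_def C_def T_def spP by blast
    show "S \<in> sets ?P" using S sP by simp
  qed
  finally show ?thesis .
qed

subsection \<open>Ranks of maximal spacings and windows\<close>

lemma order_stat_permute:
  assumes "p permutes {1..n}"
  shows "order_stat (\<lambda>i\<in>{1..n}. x (p i)) n j = order_stat x n j"
proof -
  have "mset (map (\<lambda>i\<in>{1..n}. x (p i)) [1..<Suc n]) = image_mset (\<lambda>i. x (p i)) (mset_set {1..n})"
    by (auto simp: atLeastLessThanSuc_atLeastAtMost intro!: image_mset_cong simp del: upt_Suc)
  also have "\<dots> = image_mset x (image_mset p (mset_set {1..n}))"
    by (simp add: multiset.map_comp comp_def)
  also have "\<dots> = mset (map x [1..<Suc n])"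
    using permutes_inj_on[OF assms] permutes_image[OF assms]
    by (simp add: image_mset_mset_set atLeastLessThanSuc_atLeastAtMost del: upt_Suc)
  finally have "sort (map (\<lambda>i\<in>{1..n}. x (p i)) [1..<Suc n]) = sort (map x [1..<Suc n])"
    by (metis mset_sort properties_for_sort sorted_sort)
  then show ?thesis by (simp only: order_stat_def)
qed

text \<open>The two spacing functions are equal as functions, so \<open>arg_max_on\<close> makes the
  same choice for both, even when there are ties.\<close>

lemma max_spacing_rank_permute:
  assumes "p permutes {1..n}"
  shows "max_spacing_rank m (\<lambda>i\<in>{1..n}. x (p i)) n = max_spacing_rank m x n"
proof -
  have "spacing m (\<lambda>i\<in>{1..n}. x (p i)) n = spacing m x n"
    by (simp only: spacing_def[abs_def] order_stat_permute[OF assms])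
  then show ?thesis by (simp only: max_spacing_rank_def max_spacing_pos_def)
qed

text \<open>This is the identity permutation; it passes between a sample and the extensional point
  that represents it in the product space.\<close>

lemma max_spacing_rank_restrict:
  "max_spacing_rank m (\<lambda>i\<in>{1..n}. x i) n = max_spacing_rank m x n"
  using max_spacing_rank_permute[OF permutes_id, of m x n] by (simp only: id_apply)

lemma order_stat_ordered:
  assumes "\<And>i j. 1 \<le> i \<Longrightarrow> i < j \<Longrightarrow> j \<le> n \<Longrightarrow> x i \<le> (x j :: real)" "1 \<le> j" "j \<le> n"
  shows "order_stat x n j = x j"
proof -
  have "sorted (map x [1..<Suc n])"
    unfolding sorted_map
    by (rule sorted_wrt_mono_rel[of _ "(<)"]) (use assms(1) in \<open>auto simp: sorted_wrt_upt simp del: upt_Suc\<close>)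
  then show ?thesis
    using assms(2,3) by (simp add: order_stat_def sorted_sort_id del: upt_Suc)
qed

text \<open>In a sorted list the entries up to t form an initial segment, so their number decides
  whether position k belongs to it.\<close>

lemma sorted_nth_le_iff:
  assumes "sorted xs" "k < length xs"
  shows "xs ! k \<le> t \<longleftrightarrow> k < length (filter (\<lambda>z. z \<le> t) xs)"
  using assms
proof (induction xs arbitrary: k)
  case (Cons a xs)
  show ?case
  proof (cases "a \<le> t")
    case True
    then show ?thesis using Cons by (cases k) auto
  next
    case False
    then have "filter (\<lambda>z. z \<le> t) (a # xs) = []"
      using Cons.prems by (auto simp: filter_empty_conv)
    moreover have "a \<le> (a # xs) ! k"
      using Cons.prems by (cases k) auto
    ultimately show ?thesis using False by auto
  qed
qed simp

text \<open>The j-th order statistic is at most t exactly when more than j - 1 observations are, and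
  that count is a finite sum of measurable indicators.\<close>

lemma measurable_order_stat:
  assumes X: "\<And>i. i \<in> {1..n} \<Longrightarrow> X i \<in> borel_measurable M" and "j \<le> n"
  shows "(\<lambda>\<omega>. order_stat (\<lambda>i. X i \<omega>) n j) \<in> borel_measurable M"
proof (cases "j = 0")
  case False
  have iff: "order_stat (\<lambda>i. X i \<omega>) n j \<le> t
      \<longleftrightarrow> real (j - 1) < (\<Sum>i\<in>{1..n}. indicator {..t} (X i \<omega>))" for \<omega> t
  proof -
    have *: "sort xs ! (j - 1) \<le> t \<longleftrightarrow> j - 1 < length (filter (\<lambda>z. z \<le> t) xs)"
      if "j - 1 < length xs" for xs :: "real list"
      using sorted_nth_le_iff[of "sort xs" "j - 1" t] that
      by (simp add: size_mset[symmetric] del: size_mset)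
    have "length (filter (\<lambda>z. z \<le> t) (map (\<lambda>i. X i \<omega>) [1..<Suc n])) = card {i\<in>{1..n}. X i \<omega> \<le> t}"
    proof -
      have "length (filter (\<lambda>z. z \<le> t) (map (\<lambda>i. X i \<omega>) [1..<Suc n]))
          = card (set (filter (\<lambda>i. X i \<omega> \<le> t) [1..<Suc n]))"
        by (simp only: filter_map length_map comp_def distinct_card distinct_filter distinct_upt)
      also have "set (filter (\<lambda>i. X i \<omega> \<le> t) [1..<Suc n]) = {i\<in>{1..n}. X i \<omega> \<le> t}"
        by (auto simp del: upt_Suc)
      finally show ?thesis .
    qed
    moreover have "real (card {i\<in>{1..n}. X i \<omega> \<le> t}) = (\<Sum>i\<in>{1..n}. indicator {..t} (X i \<omega>))"
      by (simp add: sum.If_cases indicator_def Int_def)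
    ultimately show ?thesis
      using False \<open>j \<le> n\<close> *[of "map (\<lambda>i. X i \<omega>) [1..<Suc n]"]
      by (simp only: order_stat_def if_False length_map length_upt of_nat_less_iff[symmetric, where 'a = real])
  qed
  have "{\<omega> \<in> space M. order_stat (\<lambda>i. X i \<omega>) n j \<le> t} \<in> sets M" for t
    unfolding iff
    by (intro borel_measurable_less borel_measurable_const borel_measurable_sum
        measurable_compose[OF X borel_measurable_indicator]) auto
  then show ?thesis by (simp add: borel_measurable_iff_le)
qed (simp add: order_stat_def)

text \<open>The choice made at ties is unspecified, but it is a function of the set \<open>T\<close>
  of maximisers. This set takes finitely many values, each on a measurable event, so any function of
  it is measurable.\<close>

lemma measurable_max_spacing_rank:
  assumes X: "\<And>i. i \<in> {1..n} \<Longrightarrow> X i \<in> borel_measurable M"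
  shows "(\<lambda>\<omega>. max_spacing_rank m (\<lambda>i. X i \<omega>) n) \<in> M \<rightarrow>\<^sub>M count_space UNIV"
proof -
  define S where "S \<omega> = spacing m (\<lambda>i. X i \<omega>) n" for \<omega>
  have S: "(\<lambda>\<omega>. S \<omega> j) \<in> borel_measurable M" if "j \<in> {m..n}" for j
    using that unfolding S_def spacing_def
    by (intro borel_measurable_diff measurable_order_stat X) auto
  define T where "T \<omega> = {j. is_arg_max (S \<omega>) (\<lambda>j. j \<in> {m..n}) j}" for \<omega>
  have T: "T \<in> M \<rightarrow>\<^sub>M count_space (Pow {m..n})"
  proof (subst measurable_count_space_eq2[OF finite_Pow_iff[THEN iffD2, OF finite_atLeastAtMost]], safe)
    fix \<omega> j assume "j \<in> T \<omega>" then show "j \<in> {m..n}" by (simp add: T_def is_arg_max_def)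
  next
    fix A assume A: "A \<subseteq> {m..n}"
    have "T -` {A} \<inter> space M = {\<omega> \<in> space M. \<forall>j\<in>{m..n}. j \<in> A \<longleftrightarrow> (\<forall>k\<in>{m..n}. S \<omega> k \<le> S \<omega> j)}"
    proof -
      have "T \<omega> = A \<longleftrightarrow> (\<forall>j\<in>{m..n}. j \<in> A \<longleftrightarrow> (\<forall>k\<in>{m..n}. S \<omega> k \<le> S \<omega> j))" for \<omega>
      proof -
        have "T \<omega> = {j\<in>{m..n}. \<forall>k\<in>{m..n}. S \<omega> k \<le> S \<omega> j}"
          unfolding T_def is_arg_max_def not_less[symmetric] by blast
        then show ?thesis using A by blast
      qed
      then show ?thesis by blast
    qed
    also have "\<dots> \<in> sets M"
    proof (intro sets.sets_Collect_finite_All finite_atLeastAtMost)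
      fix j assume j: "j \<in> {m..n}"
      have "{\<omega> \<in> space M. \<forall>k\<in>{m..n}. S \<omega> k \<le> S \<omega> j} \<in> sets M"
        by (intro sets.sets_Collect_finite_All finite_atLeastAtMost borel_measurable_le S j)
      then show "{\<omega> \<in> space M. (j \<in> A) = (\<forall>k\<in>{m..n}. S \<omega> k \<le> S \<omega> j)} \<in> sets M"
        by (cases "j \<in> A") (simp_all only: simp_thms sets.sets_Collect_neg)
    qed
    finally show "T -` {A} \<inter> space M \<in> sets M" .
  qed
  have "(\<lambda>\<omega>. max_spacing_rank m (\<lambda>i. X i \<omega>) n) = (\<lambda>\<omega>. n - (SOME j. j \<in> T \<omega>) + 1)"
    by (simp add: max_spacing_rank_def max_spacing_pos_def arg_max_on_def arg_max_def T_def S_def)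
  also have "\<dots> \<in> M \<rightarrow>\<^sub>M count_space UNIV"
    by (rule measurable_compose[OF T]) simp
  finally show ?thesis .
qed

section \<open>Strict maximisers and the limiting rank\<close>

lemma arg_max_on_eqI:
  fixes f :: "'a \<Rightarrow> 'b :: linorder"
  assumes "r \<in> A" "\<And>s. s \<in> A \<Longrightarrow> s \<noteq> r \<Longrightarrow> f s < f r"
  shows "arg_max_on f A = r"
proof -
  have "is_arg_max f (\<lambda>r. r \<in> A) s \<longleftrightarrow> s = r" for s
  proof
    assume "is_arg_max f (\<lambda>r. r \<in> A) s"
    then show "s = r" using assms unfolding is_arg_max_def by blast
  next
    assume "s = r"
    then show "is_arg_max f (\<lambda>r. r \<in> A) s"
      using assms unfolding is_arg_max_def by (metis less_asym)
  qed
  then show ?thesis by (simp add: arg_max_on_def arg_max_def)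
qed

lemma ex1_is_arg_max_iff:
  fixes f :: "'a \<Rightarrow> 'b :: linorder"
  shows "(\<exists>!r. is_arg_max f (\<lambda>r. r \<in> A) r) \<longleftrightarrow> (\<exists>r\<in>A. \<forall>s\<in>A. s \<noteq> r \<longrightarrow> f s < f r)"
proof
  assume "\<exists>!r. is_arg_max f (\<lambda>r. r \<in> A) r"
  then obtain r where r: "is_arg_max f (\<lambda>r. r \<in> A) r" "\<And>s. is_arg_max f (\<lambda>r. r \<in> A) s \<Longrightarrow> s = r"
    by blast
  have "f s < f r" if "s \<in> A" "s \<noteq> r" for s
    using r(1) r(2)[of s] that unfolding is_arg_max_def
    by (metis not_less_iff_gr_or_eq)
  then show "\<exists>r\<in>A. \<forall>s\<in>A. s \<noteq> r \<longrightarrow> f s < f r"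
    using r(1) by (auto simp: is_arg_max_def)
next
  assume "\<exists>r\<in>A. \<forall>s\<in>A. s \<noteq> r \<longrightarrow> f s < f r"
  then obtain r where r: "r \<in> A" "\<And>s. s \<in> A \<Longrightarrow> s \<noteq> r \<Longrightarrow> f s < f r" by blast
  then have "is_arg_max f (\<lambda>r. r \<in> A) s \<longleftrightarrow> s = r" for s
    unfolding is_arg_max_def by (metis less_asym)
  then show "\<exists>!r. is_arg_max f (\<lambda>r. r \<in> A) r" by simp
qed

text \<open>In a linear order a unique maximiser is a strict one. This removes the choice operator
  from all later arguments; \<open>r = 0\<close> is excluded because it marks the absence of a
  unique maximiser.\<close>

lemma limit_rank_eq_iff:
  assumes "r \<ge> 1"
  shows "limit_rank m y = r \<longleftrightarrow> (\<forall>s\<ge>1. s \<noteq> r \<longrightarrow> window_sum m y s < window_sum m y r)"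
proof
  assume R: "limit_rank m y = r"
  with assms have "\<exists>!r. is_arg_max (window_sum m y) (\<lambda>r. r \<in> {1..}) r"
    by (auto simp: limit_rank_def split: if_splits)
  then obtain q where q: "q \<in> {1..}" "\<forall>s\<in>{1..}. s \<noteq> q \<longrightarrow> window_sum m y s < window_sum m y q"
    and "arg_max_on (window_sum m y) {1..} = r"
    using R unfolding limit_rank_def ex1_is_arg_max_iff by (auto split: if_splits)
  moreover have "arg_max_on (window_sum m y) {1..} = q"
    using q by (intro arg_max_on_eqI) auto
  ultimately show "\<forall>s\<ge>1. s \<noteq> r \<longrightarrow> window_sum m y s < window_sum m y r" by auto
next
  assume *: "\<forall>s\<ge>1. s \<noteq> r \<longrightarrow> window_sum m y s < window_sum m y r"
  then have "\<exists>!r. is_arg_max (window_sum m y) (\<lambda>r. r \<in> {1..}) r"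
    using assms unfolding ex1_is_arg_max_iff by (intro bexI[of _ r]) auto
  moreover have "arg_max_on (window_sum m y) {1..} = r"
    using assms * by (intro arg_max_on_eqI) auto
  ultimately show "limit_rank m y = r" by (simp add: limit_rank_def)
qed

lemma limit_rank_nonzero_iff:
  "limit_rank m y \<noteq> 0 \<longleftrightarrow> (\<exists>!r. is_arg_max (window_sum m y) (\<lambda>r. r \<in> {1..}) r)"
proof
  assume "\<exists>!r. is_arg_max (window_sum m y) (\<lambda>r. r \<in> {1..}) r"
  then obtain r where "r \<ge> 1" "\<forall>s\<ge>1. s \<noteq> r \<longrightarrow> window_sum m y s < window_sum m y r"
    unfolding ex1_is_arg_max_iff by auto
  then show "limit_rank m y \<noteq> 0"
    using limit_rank_eq_iff[of r m y] by simp
qed (simp add: limit_rank_def split: if_splits)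

text \<open>For r >= 1 the event is a countable intersection of strict comparisons between window
  sums.\<close>

lemma measurable_limit_rank:
  assumes "\<And>r. r \<ge> 1 \<Longrightarrow> Y r \<in> borel_measurable M"
  shows "(\<lambda>\<omega>. limit_rank m (\<lambda>r. Y r \<omega>)) \<in> M \<rightarrow>\<^sub>M count_space UNIV"
proof -
  let ?R = "\<lambda>\<omega>. limit_rank m (\<lambda>r. Y r \<omega>)"
  have W: "(\<lambda>\<omega>. window_sum m (\<lambda>r. Y r \<omega>) r) \<in> borel_measurable M" if "r \<ge> 1" for r
    using that unfolding window_sum_def by (intro borel_measurable_sum assms) auto
  have pos: "{\<omega> \<in> space M. ?R \<omega> = r} \<in> sets M" if "r \<ge> 1" for r
  proof -
    have "{\<omega> \<in> space M. \<forall>s\<in>{1..}. s \<noteq> r \<longrightarrow> window_sum m (\<lambda>r. Y r \<omega>) s < window_sum m (\<lambda>r. Y r \<omega>) r} \<in> sets M"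
      by (intro sets.sets_Collect_countable_All' sets.sets_Collect_imp borel_measurable_less W
          sets.sets_Collect_const) (use that in auto)
    moreover have "{\<omega> \<in> space M. ?R \<omega> = r} = {\<omega> \<in> space M. \<forall>s\<in>{1..}. s \<noteq> r \<longrightarrow> window_sum m (\<lambda>r. Y r \<omega>) s < window_sum m (\<lambda>r. Y r \<omega>) r}"
      by (subst limit_rank_eq_iff[OF that]) (simp only: Ball_def atLeast_iff)
    ultimately show ?thesis by (simp only:)
  qed
  \<comment> \<open>The marker 0 is attained exactly where no positive index is, so its event is an
    intersection of countably many complements.\<close>
  have zero: "{\<omega> \<in> space M. ?R \<omega> = 0} \<in> sets M"
  proof -
    have "{\<omega> \<in> space M. ?R \<omega> = 0} = {\<omega> \<in> space M. \<forall>r\<in>{1..}. \<not> ?R \<omega> = r}"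
    proof -
      have "?R \<omega> = 0 \<longleftrightarrow> (\<forall>r\<in>{1..}. \<not> ?R \<omega> = r)" for \<omega>
      proof (cases "?R \<omega> = 0")
        case False
        then have "?R \<omega> \<in> {1..}" by (simp only: atLeast_iff One_nat_def Suc_le_eq neq0_conv)
        with False show ?thesis by blast
      qed (metis atLeast_iff not_one_le_zero)
      then show ?thesis by blast
    qed
    also have "\<dots> \<in> sets M"
      by (intro sets.sets_Collect_countable_All' sets.sets_Collect_neg pos) auto
    finally show ?thesis .
  qed
  show ?thesis
  proof (subst measurable_count_space_eq2_countable, safe)
    fix r :: nat
    have "?R -` {r} \<inter> space M = {\<omega> \<in> space M. ?R \<omega> = r}" by auto
    then show "?R -` {r} \<inter> space M \<in> sets M"
      using pos[of r] zero by (cases "r = 0") auto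
  qed auto
qed

section \<open>Coupling of the spacings with the window sums\<close>

lemma spacing_cumul:
  assumes d: "\<forall>i\<in>{1..n}. 0 < d i" and j: "m \<le> j" "j \<le> n"
  shows "spacing m (cumul n d) n j = (\<Sum>l<m. d (j - l))"
proof -
  \<comment> \<open>Partial sums of positive gaps are already sorted. The case \<open>i = 0\<close>
    matches the convention x_{0:n} = 0 with the empty sum.\<close>
  have os: "order_stat (cumul n d) n i = (\<Sum>k\<in>{1..i}. d k)" if "i \<le> n" for i
  proof (cases "i = 0")
    case False
    have "order_stat (cumul n d) n i = cumul n d i"
    proof (rule order_stat_ordered)
      show "cumul n d i \<le> cumul n d j" if "1 \<le> i" "i < j" "j \<le> n" for i j
        using cumul_in_ordered[OF d] that by (simp add: ordered_def less_imp_le)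
    qed (use that False in auto)
    then show ?thesis using that False by (simp add: cumul_def)
  qed (simp add: order_stat_def)
  have "(\<Sum>k\<in>{1..j}. d k) = (\<Sum>k\<in>{1..j-m}. d k) + (\<Sum>k\<in>{j-m<..j}. d k)"
    using j by (subst sum.union_disjoint[symmetric]) (auto intro!: sum.cong)
  moreover have "(\<Sum>k\<in>{j-m<..j}. d k) = (\<Sum>l<m. d (j - l))"
    using j by (intro sum.reindex_bij_witness[of _ "\<lambda>l. j - l" "\<lambda>k. j - k"]) auto
  ultimately show ?thesis
    using j os[of j] os[of "j - m"] by (simp add: spacing_def)
qed

text \<open>Position j corresponds to the window starting at n + 1 - j. All windows that occur for
  sample size n are among those defining \<open>limit_rank\<close>, so its strict maximiser remains
  one as soon as its own window fits into the first n gaps.\<close>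

lemma max_spacing_rank_cumul:
  assumes d: "\<forall>i\<in>{1..n}. 0 < d i" and dy: "\<And>i. i \<in> {1..n} \<Longrightarrow> d i = y (Suc n - i)"
    and m: "1 \<le> m" and r: "limit_rank m y = r" "1 \<le> r" "r \<le> Suc n - m"
  shows "max_spacing_rank m (cumul n d) n = r"
proof -
  \<comment> \<open>Since r >= 1, the bound on r forces the truncated difference to be positive,
    hence \<open>m \<le> n\<close>.\<close>
  have mn: "m \<le> n" "r + m \<le> Suc n" using r by auto
  have sp: "spacing m (cumul n d) n j = window_sum m y (Suc n - j)" if "j \<in> {m..n}" for j
  proof -
    have "spacing m (cumul n d) n j = (\<Sum>l<m. d (j - l))"
      using that by (intro spacing_cumul d) auto
    also have "\<dots> = (\<Sum>l<m. y (Suc n - j + l))"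
    proof (rule sum.cong)
      fix l assume "l \<in> {..<m}"
      then have "j - l \<in> {1..n}" "Suc n - (j - l) = Suc n - j + l" using that by auto
      then show "d (j - l) = y (Suc n - j + l)" using dy by metis
    qed simp
    finally show ?thesis by (simp add: window_sum_def)
  qed
  have "max_spacing_pos m (cumul n d) n = Suc n - r"
    unfolding max_spacing_pos_def
  proof (rule arg_max_on_eqI)
    show 0: "Suc n - r \<in> {m..n}" using mn r m by auto
    fix j assume j: "j \<in> {m..n}" "j \<noteq> Suc n - r"
    then have "Suc n - j \<ge> 1" "Suc n - j \<noteq> r" "Suc n - (Suc n - r) = r" using mn m r by auto
    then show "spacing m (cumul n d) n j < spacing m (cumul n d) n (Suc n - r)"
      using r limit_rank_eq_iff[of r m y] unfolding sp[OF j(1)] sp[OF 0] by simp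
  qed
  then show ?thesis using mn m r by (simp add: max_spacing_rank_def)
qed

lemma (in prob_space) distr_indep_exponential:
  assumes I: "I \<noteq> {}" and indep: "indep_vars (\<lambda>_. borel) X I"
    and X: "\<And>i. i \<in> I \<Longrightarrow> distributed M lborel (X i) (exponential_density (l i))"
  shows "distr M (Pi\<^sub>M I (\<lambda>_. lborel)) (\<lambda>\<omega>. \<lambda>i\<in>I. X i \<omega>) = Pi\<^sub>M I (\<lambda>i. exp_law (l i))"
proof -
  have rv: "random_variable borel (X i)" if "i \<in> I" for i
    using distributed_measurable[OF X[OF that]] by simp
  have "distr M (Pi\<^sub>M I (\<lambda>_. lborel)) (\<lambda>\<omega>. \<lambda>i\<in>I. X i \<omega>)
      = distr M (Pi\<^sub>M I (\<lambda>_. borel)) (\<lambda>\<omega>. \<lambda>i\<in>I. X i \<omega>)"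
    by (intro distr_cong sets_PiM_cong) auto
  also have "\<dots> = Pi\<^sub>M I (\<lambda>i. distr M borel (X i))"
    using indep indep_vars_iff_distr_eq_PiM'[OF I rv] by simp
  also have "\<dots> = Pi\<^sub>M I (\<lambda>i. exp_law (l i))"
  proof (rule PiM_cong)
    fix i assume "i \<in> I"
    have "distr M borel (X i) = distr M lborel (X i)" by (rule distr_cong) auto
    then show "distr M borel (X i) = exp_law (l i)"
      using distributed_distr_eq_density[OF X[OF \<open>i \<in> I\<close>]] by simp
  qed simp
  finally show ?thesis .
qed

lemma (in prob_space) AE_exponential_pos:
  assumes "distributed M lborel X (exponential_density l)" "0 < l"
  shows "AE \<omega> in M. 0 < X \<omega>"
proof -
  have "\<P>(\<omega> in M. 0 < X \<omega>) = 1"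
    using exponential_distributedD_gt[OF assms(1) _ assms(2), of 0] by simp
  moreover have "{\<omega> \<in> space M. 0 < X \<omega>} \<in> events"
    using distributed_measurable[OF assms(1)] by (intro borel_measurable_less) auto
  ultimately show ?thesis by (subst (asm) prob_Collect_eq_1) auto
qed

text \<open>The two sides live on unrelated probability spaces and are compared through laws on the
  product space. The reversed \<open>Y\<close> have the law of the gaps, and
  \<open>exponential_order_spacings_le\<close> passes from the gaps to the sample because the rank
  is invariant under permutations.\<close>

lemma prob_limit_rank_le:
  fixes M :: "'a measure" and N :: "'b measure"
  assumes m: "m \<ge> 1" and n: "n \<ge> 1" and "prob_space M" and "prob_space N"
    and X: "prob_space.indep_vars M (\<lambda>_. borel) X {1..n}"
      "\<And>i. i \<in> {1..n} \<Longrightarrow> distributed M lborel (X i) (exponential_density 1)"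
    and Y: "prob_space.indep_vars N (\<lambda>_. borel) Y {1..}"
      "\<And>r. r \<ge> 1 \<Longrightarrow> distributed N lborel (Y r) (exponential_density (real r))"
  shows "measure N {\<omega> \<in> space N. limit_rank m (\<lambda>r. Y r \<omega>) \<in> A \<inter> {1..Suc n - m}}
    \<le> measure M {\<omega> \<in> space M. max_spacing_rank m (\<lambda>i. X i \<omega>) n \<in> A}"
proof -
  interpret M: prob_space M by fact
  interpret N: prob_space N by fact
  let ?L = "Pi\<^sub>M {1..n} (\<lambda>_. lborel :: real measure)"
  define S where "S = {x \<in> space ?L. max_spacing_rank m x n \<in> A}"
  define D where "D = {d \<in> space ?L. (\<forall>i\<in>{1..n}. 0 < d i) \<and> cumul n d \<in> S}"
  have "(\<lambda>x. max_spacing_rank m (\<lambda>i. x i) n) \<in> ?L \<rightarrow>\<^sub>M count_space UNIV"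
  proof (rule measurable_max_spacing_rank)
    show "(\<lambda>x. x i) \<in> borel_measurable ?L" if "i \<in> {1..n}" for i
      using measurable_component_singleton[OF that, of "\<lambda>_. lborel :: real measure"] by simp
  qed
  from measurable_sets[OF this, of A] have S: "S \<in> sets ?L"
    by (simp add: S_def vimage_def Int_def conj_commute)
  have D: "D \<in> sets ?L" unfolding D_def by (rule sets_positive_cumul[OF S])
  have sym: "x \<in> S" if "p permutes {1..n}" "x \<in> space ?L" "(\<lambda>i\<in>{1..n}. x (p i)) \<in> S" for x p
    using that max_spacing_rank_permute[OF that(1), of m x] by (simp add: S_def del: One_nat_def)
  \<comment> \<open>Reversal gives the i-th gap from below the rate n + 1 - i.\<close>
  define V where "V \<omega> = (\<lambda>i\<in>{1..n}. Y (Suc n - i) \<omega>)" for \<omega>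
  have Yn: "N.random_variable borel (Y r)" if "r \<ge> 1" for r
    using distributed_measurable[OF Y(2)[OF that]] by simp
  have Xn: "M.random_variable borel (X i)" if "i \<in> {1..n}" for i
    using distributed_measurable[OF X(2)[OF that]] by simp
  have V: "V \<in> N \<rightarrow>\<^sub>M ?L" unfolding V_def
    using Yn by (intro measurable_restrict) auto
  have U: "(\<lambda>\<omega>. \<lambda>i\<in>{1..n}. X i \<omega>) \<in> M \<rightarrow>\<^sub>M ?L"
    using Xn by (intro measurable_restrict) auto
  have W: "(\<lambda>\<omega>. \<lambda>i\<in>{1..n}. Y i \<omega>) \<in> N \<rightarrow>\<^sub>M ?L"
    using Yn by (intro measurable_restrict) auto
  have Vlaw: "distr N ?L V = Pi\<^sub>M {1..n} (\<lambda>i. exp_law (real (Suc n - i)))"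
  proof -
    have 1: "distr N ?L (\<lambda>\<omega>. \<lambda>i\<in>{1..n}. Y i \<omega>) = Pi\<^sub>M {1..n} (\<lambda>i. exp_law (real i))"
      using n Y by (intro N.distr_indep_exponential N.indep_vars_subset[OF Y(1)]) auto
    let ?f = "\<lambda>x. \<lambda>i\<in>{1..n}. x (Suc n - i) :: real"
    have f: "?f \<in> ?L \<rightarrow>\<^sub>M ?L"
      by (intro measurable_restrict measurable_component_singleton) auto
    have "V = ?f \<circ> (\<lambda>\<omega>. \<lambda>i\<in>{1..n}. Y i \<omega>)"
      by (auto simp: V_def fun_eq_iff)
    then have "distr N ?L V = distr (distr N ?L (\<lambda>\<omega>. \<lambda>i\<in>{1..n}. Y i \<omega>)) ?L ?f"
      using distr_distr[OF f W] by simp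
    \<comment> \<open>Replacing the rate i by \<open>max 1 i\<close> makes every factor a
      probability measure, also at index 0, and changes nothing on \<open>{1..n}\<close>. The same
      device serves the reversed rates.\<close>
    also have "\<dots> = distr (Pi\<^sub>M {1..n} (\<lambda>i. exp_law (real (max 1 i))))
        (Pi\<^sub>M {1..n} (\<lambda>i. exp_law (real (max 1 (Suc n - i))))) ?f"
      unfolding 1 by (intro distr_cong sets_PiM_cong PiM_cong) (auto simp: max_def)
    also have "\<dots> = Pi\<^sub>M {1..n} (\<lambda>i. exp_law (real (max 1 (Suc n - i))))"
      by (rule distr_PiM_reindex[where M = "\<lambda>i. exp_law (real (max 1 i))"])
        (auto simp: inj_on_def intro!: prob_space_exponential_density)
    also have "\<dots> = Pi\<^sub>M {1..n} (\<lambda>i. exp_law (real (Suc n - i)))"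
      by (intro PiM_cong) (auto simp: max_def)
    finally show ?thesis .
  qed
  have "AE \<omega> in N. \<forall>r\<in>{1..n}. 0 < Y r \<omega>"
    using N.AE_exponential_pos[OF Y(2)] by (intro AE_finite_allI) auto
  \<comment> \<open>Where the first n gaps are positive, the coupling identifies the two ranks;
    positivity fails only on a null set.\<close>
  then have "AE \<omega> in N. \<omega> \<in> {\<omega> \<in> space N. limit_rank m (\<lambda>r. Y r \<omega>) \<in> A \<inter> {1..Suc n - m}}
      \<longrightarrow> \<omega> \<in> V -` D \<inter> space N"
  proof (rule AE_mp, intro AE_I2 impI)
    fix \<omega> assume \<omega>: "\<omega> \<in> space N" "\<forall>r\<in>{1..n}. 0 < Y r \<omega>"
      "\<omega> \<in> {\<omega> \<in> space N. limit_rank m (\<lambda>r. Y r \<omega>) \<in> A \<inter> {1..Suc n - m}}"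
    have pos: "\<forall>i\<in>{1..n}. 0 < V \<omega> i"
    proof
      fix i assume "i \<in> {1..n}"
      moreover from this have "Suc n - i \<in> {1..n}" by auto
      ultimately show "0 < V \<omega> i" using \<omega>(2) unfolding V_def by simp
    qed
    have "max_spacing_rank m (cumul n (V \<omega>)) n = limit_rank m (\<lambda>r. Y r \<omega>)"
      using \<omega> by (intro max_spacing_rank_cumul[where y = "\<lambda>r. Y r \<omega>"] pos m refl) (auto simp: V_def)
    moreover have "V \<omega> \<in> space ?L" using measurable_space[OF V \<omega>(1)] .
    moreover have "cumul n (V \<omega>) \<in> space ?L"
      using measurable_space[OF measurable_cumul \<open>V \<omega> \<in> space ?L\<close>] .
    ultimately show "\<omega> \<in> V -` D \<inter> space N"
      using \<omega> pos by (simp add: D_def S_def)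
  qed
  then have "emeasure N {\<omega> \<in> space N. limit_rank m (\<lambda>r. Y r \<omega>) \<in> A \<inter> {1..Suc n - m}}
      \<le> emeasure N (V -` D \<inter> space N)"
    using measurable_sets[OF V D] by (rule emeasure_mono_AE)
  also have "\<dots> = emeasure (Pi\<^sub>M {1..n} (\<lambda>i. exp_law (real (Suc n - i)))) D"
    unfolding Vlaw[symmetric] by (rule emeasure_distr[OF V D, symmetric])
  also have "\<dots> \<le> emeasure (Pi\<^sub>M {1..n} (\<lambda>_. exp_law 1)) S"
    unfolding D_def by (rule exponential_order_spacings_le[OF S sym])
  also have "\<dots> = emeasure M ((\<lambda>\<omega>. \<lambda>i\<in>{1..n}. X i \<omega>) -` S \<inter> space M)"
  proof -
    have "Pi\<^sub>M {1..n} (\<lambda>_. exp_law 1) = distr M ?L (\<lambda>\<omega>. \<lambda>i\<in>{1..n}. X i \<omega>)"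
      using n X by (intro M.distr_indep_exponential[symmetric]) auto
    then show ?thesis by (simp only: emeasure_distr[OF U S])
  qed
  also have "(\<lambda>\<omega>. \<lambda>i\<in>{1..n}. X i \<omega>) -` S \<inter> space M
      = {\<omega> \<in> space M. max_spacing_rank m (\<lambda>i. X i \<omega>) n \<in> A}"
  proof -
    have "(\<lambda>i\<in>{1..n}. X i \<omega>) \<in> S \<longleftrightarrow> max_spacing_rank m (\<lambda>i. X i \<omega>) n \<in> A" if "\<omega> \<in> space M" for \<omega>
      using measurable_space[OF U that] by (simp add: S_def max_spacing_rank_restrict del: One_nat_def)
    then show ?thesis by auto
  qed
  finally show ?thesis
    by (simp add: N.emeasure_eq_measure M.emeasure_eq_measure)
qed

subsection \<open>The limiting rank\<close>

text \<open>The law of \<open>A\<close> has no atoms, so under the product law every section of the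
  diagonal at a fixed value of \<open>B\<close> is null, and so is the diagonal.\<close>

lemma (in prob_space) AE_neq_of_indep_density:
  fixes A B :: "'a \<Rightarrow> real"
  assumes indep: "indep_var borel A borel B" and A: "distributed M lborel A f"
  shows "AE \<omega> in M. A \<omega> \<noteq> B \<omega>"
proof -
  have rv: "random_variable borel A" "random_variable borel B"
    and joint: "distr M borel A \<Otimes>\<^sub>M distr M borel B = distr M (borel \<Otimes>\<^sub>M borel) (\<lambda>\<omega>. (A \<omega>, B \<omega>))"
    using indep unfolding indep_var_distribution_eq by auto
  interpret A: prob_space "distr M borel A" using rv by (intro prob_space_distr)
  interpret B: prob_space "distr M borel B" using rv by (intro prob_space_distr)
  interpret P: pair_sigma_finite "distr M borel A" "distr M borel B" ..
  have "distr M borel A = distr M lborel A" by (rule distr_cong) auto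
  then have lawA: "distr M borel A = density lborel f"
    using distributed_distr_eq_density[OF A] by simp
  have null: "emeasure (distr M borel A) {b} = 0" for b
  proof -
    have "AE x in lborel. x \<in> {b} \<longrightarrow> f x = 0"
      using AE_lborel_singleton[of b] by eventually_elim auto
    then have "{b} \<in> null_sets (density lborel f)"
      using distributed_borel_measurable[OF A] by (subst null_sets_density_iff) auto
    then show ?thesis by (simp add: lawA null_setsD1)
  qed
  let ?D = "{z :: real \<times> real. fst z = snd z}"
  have "{z \<in> space (borel \<Otimes>\<^sub>M borel :: (real \<times> real) measure). fst z = snd z} \<in> sets (borel \<Otimes>\<^sub>M borel)"
    by measurable
  then have D: "?D \<in> sets (borel \<Otimes>\<^sub>M borel)" by (simp add: space_pair_measure)
  have "emeasure (distr M borel A \<Otimes>\<^sub>M distr M borel B) ?D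
      = (\<integral>\<^sup>+ b. emeasure (distr M borel A) ((\<lambda>a. (a, b)) -` ?D) \<partial>distr M borel B)"
    using D by (intro P.emeasure_pair_measure_alt2) (simp cong: sets_pair_measure_cong)
  also have "\<dots> = 0"
    using null by (simp add: vimage_def)
  finally have "emeasure M ((\<lambda>\<omega>. (A \<omega>, B \<omega>)) -` ?D \<inter> space M) = 0"
    unfolding joint using rv D by (subst (asm) emeasure_distr) auto
  then show ?thesis
    using rv D by (intro AE_I[of _ _ "(\<lambda>\<omega>. (A \<omega>, B \<omega>)) -` ?D \<inter> space M"])
      (auto intro: measurable_sets)
qed

section \<open>Windows over the infinite sequence of exponentials\<close>

locale exponential_sequence = prob_space N for N :: "'b measure" +
  fixes Y :: "nat \<Rightarrow> 'b \<Rightarrow> real"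
  assumes indep: "indep_vars (\<lambda>_. borel) Y {1..}"
    and law: "r \<ge> 1 \<Longrightarrow> distributed N lborel (Y r) (exponential_density (real r))"
begin

lemma rv: "r \<ge> 1 \<Longrightarrow> random_variable borel (Y r)"
  using distributed_measurable[OF law] by simp

text \<open>For \<open>r < s\<close> the summand \<open>Y r\<close> occurs only in the window at \<open>r\<close>, so a tie forces it to
  equal an independent random variable.\<close>

lemma AE_no_tie:
  assumes m: "1 \<le> m" and rs: "1 \<le> r" "r < s"
  shows "AE \<omega> in N. window_sum m (\<lambda>r. Y r \<omega>) r \<noteq> window_sum m (\<lambda>r. Y r \<omega>) s"
proof -
  \<comment> \<open>On \<open>J\<close> the coefficient is the difference of the membership
    indicators of the two windows. The value 1 at r makes the rescaled variable there equal to
    \<open>Y r\<close>, so that a tie reads: \<open>Y r\<close> equals the weighted sum over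
    \<open>J\<close>.\<close>
  define c :: "nat \<Rightarrow> real" where
    "c j = (if j = r then 1 else of_bool (j \<in> {s..<s + m}) - of_bool (j \<in> {r..<r + m}))" for j
  define J where "J = {Suc r..<s + m}"
  have W: "window_sum m y t = (\<Sum>j\<in>insert r J. of_bool (j \<in> {t..<t + m}) * y j)"
    if "r \<le> t" "t \<le> s" for t and y :: "nat \<Rightarrow> real"
  proof -
    have "window_sum m y t = (\<Sum>j\<in>{t..<t + m}. y j)"
      unfolding window_sum_def
      by (intro sum.reindex_bij_witness[of _ "\<lambda>j. j - t" "\<lambda>l. t + l"]) auto
    also have "\<dots> = (\<Sum>j\<in>insert r J. of_bool (j \<in> {t..<t + m}) * y j)"
      using that rs by (intro sum.mono_neutral_cong_left) (auto simp: J_def)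
    finally show ?thesis .
  qed
  have J: "finite J" "r \<notin> J" by (auto simp: J_def)
  have diff: "window_sum m y s - window_sum m y r = (\<Sum>j\<in>J. c j * y j) - y r" for y
  proof -
    have "window_sum m y s - window_sum m y r
        = (\<Sum>j\<in>J. (of_bool (j \<in> {s..<s + m}) - of_bool (j \<in> {r..<r + m})) * y j) - y r"
      using J rs m W[of r y] W[of s y] by (simp add: sum_subtractf left_diff_distrib)
    also have "(\<Sum>j\<in>J. (of_bool (j \<in> {s..<s + m}) - of_bool (j \<in> {r..<r + m})) * y j)
        = (\<Sum>j\<in>J. c j * y j)"
      using J by (intro sum.cong) (auto simp: c_def)
    finally show ?thesis .
  qed
  have "indep_vars (\<lambda>_. borel) Y (insert r J)"
    using rs by (intro indep_vars_subset[OF indep]) (auto simp: J_def)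
  then have "indep_vars (\<lambda>_. borel) (\<lambda>j \<omega>. c j * Y j \<omega>) (insert r J)"
    by (rule indep_vars_compose2) auto
  from indep_vars_sum[OF J this] 
  have "indep_var borel (Y r) borel (\<lambda>\<omega>. \<Sum>j\<in>J. c j * Y j \<omega>)"
    by (simp add: c_def)
  from AE_neq_of_indep_density[OF this law[OF rs(1)]] show ?thesis
  proof eventually_elim
    case (elim \<omega>)
    then show ?case using diff[of "\<lambda>j. Y j \<omega>"] by auto
  qed
qed

text \<open>The exceedance probabilities exp (- e r) form a convergent geometric series, so
  Borel-Cantelli applies. Indices are shifted by one because the rates start at 1.\<close>

lemma AE_eventually_small:
  assumes "0 < e"
  shows "AE \<omega> in N. eventually (\<lambda>r. Y r \<omega> \<le> e) sequentially"
proof -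
  let ?A = "\<lambda>r. {\<omega> \<in> space N. e < Y (Suc r) \<omega>}"
  have A: "?A r \<in> sets N" for r
    using rv[of "Suc r"] by (intro borel_measurable_less) auto
  have "measure N (?A r) = exp (- e) * exp (- e) ^ r" for r
    using exponential_distributedD_gt[OF law[of "Suc r"], of e] assms
    by (simp add: exp_of_nat_mult[symmetric] exp_add[symmetric] algebra_simps)
  moreover have "summable (\<lambda>r. exp (- e) * exp (- e) ^ r)"
    using assms by (intro summable_mult summable_geometric) auto
  ultimately have "AE \<omega> in N. eventually (\<lambda>r. \<omega> \<in> space N - ?A r) sequentially"
    using A by (intro borel_cantelli_AE1) (auto simp: less_top[symmetric])
  then show ?thesis
  proof eventually_elim
    case (elim \<omega>)
    then have "eventually (\<lambda>r. Y (Suc r) \<omega> \<le> e) sequentially"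
      by eventually_elim auto
    then show ?case by (subst (asm) eventually_sequentially_Suc)
  qed
qed

text \<open>Window sums far out fall below the positive first one, which leaves finitely many
  candidates, so a maximum exists; the absence of ties makes it unique.\<close>

lemma AE_unique_max:
  assumes m: "1 \<le> m"
  shows "AE \<omega> in N. \<exists>!r. is_arg_max (window_sum m (\<lambda>r. Y r \<omega>)) (\<lambda>r. r \<in> {1..}) r"
proof -
  have pos: "AE \<omega> in N. \<forall>r\<in>{1..}. 0 < Y r \<omega>"
    using AE_exponential_pos[OF law] by (intro AE_ball_countable') auto
  \<comment> \<open>Countably many thresholds suffice, so the exceptional null sets can be
    united.\<close>
  have small: "AE \<omega> in N. \<forall>k. eventually (\<lambda>r. Y r \<omega> \<le> 1 / real (Suc k)) sequentially"
    using AE_eventually_small by (subst AE_all_countable) auto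
  have noties: "AE \<omega> in N. \<forall>r\<in>{1..}. \<forall>s\<in>{r<..}.
      window_sum m (\<lambda>r. Y r \<omega>) r \<noteq> window_sum m (\<lambda>r. Y r \<omega>) s"
    using AE_no_tie[OF m] by (intro AE_ball_countable') auto
  from pos small noties show ?thesis
  proof eventually_elim
    case (elim \<omega>)
    let ?W = "window_sum m (\<lambda>r. Y r \<omega>)"
    have "0 < ?W 1" unfolding window_sum_def
      using elim(1) m by (intro sum_pos) (auto simp: lessThan_empty_iff)
    \<comment> \<open>With this k, m summands of size at most 1 / (k + 1) stay below the first
      window sum.\<close>
    then obtain k where k: "real m / ?W 1 < real (Suc k)"
      using reals_Archimedean2 by (metis less_trans lessI of_nat_less_iff)
    obtain K where K: "\<And>r. r \<ge> K \<Longrightarrow> Y r \<omega> \<le> 1 / real (Suc k)"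
      using elim(2)[rule_format, of k] by (auto simp: eventually_sequentially)
    have tail: "?W r < ?W 1" if "r \<ge> K" for r
    proof -
      have "?W r \<le> real (card {..<m}) * (1 / real (Suc k))"
        unfolding window_sum_def using that K by (intro sum_bounded_above) auto
      also have "\<dots> < ?W 1"
        using k \<open>0 < ?W 1\<close> by (simp add: field_simps)
      finally show ?thesis .
    qed
    \<comment> \<open>The upper end \<open>Suc K\<close> keeps the index 1 in the range even if
      \<open>K = 0\<close>.\<close>
    have fin: "finite (?W ` {1..Suc K})" "?W ` {1..Suc K} \<noteq> {}" by auto
    then obtain r where r: "r \<in> {1..Suc K}" "?W r = Max (?W ` {1..Suc K})"
      using Max_in by (metis (no_types, lifting) imageE)
    have le: "?W s \<le> ?W r" if "s \<ge> 1" for s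
    proof (cases "s \<le> Suc K")
      case True
      then show ?thesis using that fin r by (auto intro: Max_ge)
    next
      case False
      then have "?W s < ?W 1" by (intro tail) auto
      also have "?W 1 \<le> ?W r" using fin r by (auto intro: Max_ge)
      finally show ?thesis by simp
    qed
    have "?W s < ?W r" if "s \<in> {1..}" "s \<noteq> r" for s
    proof -
      have "?W s \<noteq> ?W r"
        using elim(3) that r(1) by (metis atLeast_iff atLeastAtMost_iff greaterThan_iff nat_neq_iff)
      then show ?thesis using le[of s] that by simp
    qed
    then show ?case
      unfolding ex1_is_arg_max_iff using r(1) by (intro bexI[of _ r]) auto
  qed
qed

text \<open>By independence the probability is an infinite product. Its factors are positive and
  eventually equal 1 - exp (- e i), with summable defects, so the product does not vanish.\<close>

lemma prob_all_bounded_pos: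
  assumes B: "\<And>i. i \<ge> 1 \<Longrightarrow> B i \<in> sets borel"
    and pos: "\<And>i. i \<ge> 1 \<Longrightarrow> 0 < prob (Y i -` B i \<inter> space N)"
    and tail: "\<And>i. i \<ge> k \<Longrightarrow> B i = {..e}" and e: "0 < e"
  shows "0 < prob {\<omega> \<in> space N. \<forall>i\<in>{1..}. Y i \<omega> \<in> B i}"
proof -
  define a where "a i = prob (Y i -` B i \<inter> space N)" for i
  define g where "g i = exp (- e) ^ i" for i :: nat
  have a: "a i = 1 - g i" if "i \<ge> k" "i \<ge> 1" for i
  proof -
    have "Y i -` B i \<inter> space N = {\<omega> \<in> space N. Y i \<omega> \<le> e}"
      using tail[OF that(1)] by auto
    then show ?thesis
      using exponential_distributedD_le[OF law[OF that(2)], of e] e that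
      by (simp add: a_def g_def exp_of_nat_mult[symmetric] mult.commute)
  qed
  have "summable g" unfolding g_def using e by (intro summable_geometric) auto
  then obtain K0 where K0: "\<And>i j. i \<ge> K0 \<Longrightarrow> norm (\<Sum>l=i..j. g l) < 1 / 2"
    using summable_partial_sum_bound[of g "1 / 2"] by auto
  \<comment> \<open>From \<open>K\<close> on, the formula \<open>a\<close> applies and the defects
    sum to less than 1/2; the factors before \<open>K\<close> form the positive constant
    \<open>c\<close>.\<close>
  define K where "K = max K0 (Suc k)"
  define c where "c = (\<Prod>i\<in>{1..<K}. a i)"
  have c: "0 < c" unfolding c_def a_def using pos by (intro prod_pos) auto
  define A where "A n = {\<omega> \<in> space N. \<forall>i\<in>{1..n}. Y i \<omega> \<in> B i}" for n
  have A: "A n \<in> events" for n unfolding A_def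
    using B rv by (intro sets.sets_Collect_finite_All) (auto intro: measurable_sets_Collect)
  have low: "c / 2 \<le> prob (A n)" if "n \<ge> K" for n
  proof -
    have n: "{1..n} \<noteq> {}" using that by (auto simp: K_def)
    have "A n = (\<Inter>i\<in>{1..n}. Y i -` B i \<inter> space N)"
      using n by (auto simp: A_def)
    also have "prob \<dots> = (\<Prod>i\<in>{1..n}. a i)"
      unfolding a_def using B n by (intro indep_varsD[OF indep]) auto
    also have "{1..n} = {1..<K} \<union> {K..n}" using that by (auto simp: K_def)
    also have "(\<Prod>i\<in>{1..<K} \<union> {K..n}. a i) = c * (\<Prod>i\<in>{K..n}. a i)"
      unfolding c_def by (subst prod.union_disjoint) auto
    finally have eq: "prob (A n) = c * (\<Prod>i\<in>{K..n}. a i)" .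
    have "1 / 2 \<le> 1 - (\<Sum>i\<in>{K..n}. g i)"
      using K0[of K n] by (auto simp: K_def)
    \<comment> \<open>A product of terms 1 - g is at least 1 minus the sum of the g, so the tail of
      the product stays above 1/2 uniformly in n.\<close>
    also have "\<dots> \<le> (\<Prod>i\<in>{K..n}. 1 - g i)"
      using e by (intro Weierstrass_prod_ineq) (auto simp: g_def power_le_one)
    also have "\<dots> = (\<Prod>i\<in>{K..n}. a i)"
      by (intro prod.cong) (auto simp: a K_def)
    finally show ?thesis using eq c by simp
  qed
  \<comment> \<open>The events decrease in n, so the uniform lower bound survives in the limit by
    continuity from above.\<close>
  have "(\<lambda>n. prob (A n)) \<longlonglongrightarrow> prob (\<Inter>n. A n)"
    using A by (intro finite_Lim_measure_decseq) (auto simp: decseq_def A_def)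
  then have "c / 2 \<le> prob (\<Inter>n. A n)"
    using low by (intro LIMSEQ_le_const) auto
  also have "(\<Inter>n. A n) = {\<omega> \<in> space N. \<forall>i\<in>{1..}. Y i \<omega> \<in> B i}"
  proof -
    have "(\<forall>n. \<forall>i\<in>{1..n}. Y i \<omega> \<in> B i) \<longleftrightarrow> (\<forall>i\<in>{1..}. Y i \<omega> \<in> B i)" for \<omega>
      by (metis atLeastAtMost_iff atLeast_iff order_refl)
    then show ?thesis by (auto simp: A_def simp del: One_nat_def)
  qed
  finally show ?thesis using c by simp
qed

lemma prob_limit_rank_pos:
  assumes m: "1 \<le> m" and r: "1 \<le> r"
  shows "0 < prob {\<omega> \<in> space N. limit_rank m (\<lambda>r. Y r \<omega>) = r}"
proof -
  \<comment> \<open>A competing window has a summand of at most 1/2 and m - 1 others of at most 1 +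
    \<delta>. This choice bounds its sum by m - \<delta>, while the window at r exceeds m.\<close>
  define \<delta> :: real where "\<delta> = 1 / (2 * real m)"
  have \<delta>: "0 < \<delta>" "real m * \<delta> = 1 / 2" using m by (auto simp: \<delta>_def)
  define B where "B i = (if i \<in> {r..<r + m} then {1<..1 + \<delta>} else {..1/2})" for i
  have "0 < prob {\<omega> \<in> space N. \<forall>i\<in>{1..}. Y i \<omega> \<in> B i}"
  proof (rule prob_all_bounded_pos)
    show "B i \<in> sets borel" for i by (simp add: B_def)
    show "B i = {..1/2}" if "i \<ge> r + m" for i using that by (simp add: B_def)
    show "0 < prob (Y i -` B i \<inter> space N)" if i: "i \<ge> 1" for i
    proof -
      have le: "prob {\<omega> \<in> space N. Y i \<omega> \<le> t} = 1 - exp (- t * real i)" if "0 \<le> t" for t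
        using exponential_distributedD_le[OF law[OF i] that] i by simp
      show ?thesis
      proof (cases "i \<in> {r..<r + m}")
        case True
        have S: "{\<omega> \<in> space N. Y i \<omega> \<le> t} \<in> events" for t
          using rv[OF i] by (intro borel_measurable_le) auto
        have "Y i -` B i \<inter> space N = {\<omega> \<in> space N. Y i \<omega> \<le> 1 + \<delta>} - {\<omega> \<in> space N. Y i \<omega> \<le> 1}"
          using True by (auto simp: B_def)
        also have "prob \<dots> = exp (- real i) - exp (- (1 + \<delta>) * real i)"
          using \<delta> S by (subst finite_measure_Diff) (auto simp: le)
        also have "\<dots> > 0"
          using mult_strict_right_mono[of 1 "1 + \<delta>" "real i"] \<delta>(1) i by (simp add: algebra_simps)
        finally show ?thesis .
      next
        case False
        then have "Y i -` B i \<inter> space N = {\<omega> \<in> space N. Y i \<omega> \<le> 1/2}"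
          by (auto simp: B_def)
        then show ?thesis using le[of "1/2"] i by simp
      qed
    qed
  qed simp
  also have "\<dots> \<le> prob {\<omega> \<in> space N. limit_rank m (\<lambda>r. Y r \<omega>) = r}"
  proof (rule finite_measure_mono)
    have "(\<lambda>\<omega>. limit_rank m (\<lambda>r. Y r \<omega>)) \<in> N \<rightarrow>\<^sub>M count_space UNIV"
      by (rule measurable_limit_rank[OF rv])
    from measurable_sets[OF this, of "{r}"]
    show "{\<omega> \<in> space N. limit_rank m (\<lambda>r. Y r \<omega>) = r} \<in> events"
      by (simp add: vimage_def Int_def conj_commute)
    show "{\<omega> \<in> space N. \<forall>i\<in>{1..}. Y i \<omega> \<in> B i} \<subseteq> {\<omega> \<in> space N. limit_rank m (\<lambda>r. Y r \<omega>) = r}"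
    proof safe
      fix \<omega> assume \<omega>: "\<forall>i\<in>{1..}. Y i \<omega> \<in> B i"
      let ?W = "window_sum m (\<lambda>r. Y r \<omega>)"
      have "(\<Sum>l<m. 1) < ?W r"
        unfolding window_sum_def
      proof (rule sum_strict_mono)
        fix l assume "l \<in> {..<m}"
        then show "1 < Y (r + l) \<omega>" using \<omega>[rule_format, of "r + l"] r by (simp add: B_def)
      qed (use m in \<open>auto simp: lessThan_empty_iff\<close>)
      then have Wr: "real m < ?W r" by simp
      have up: "Y i \<omega> \<le> 1 + \<delta>" if "i \<ge> 1" for i
        using \<omega>[rule_format, of i] that \<delta> by (auto simp: B_def split: if_splits)
      have "?W s < ?W r" if s: "s \<ge> 1" "s \<noteq> r" for s
      proof -
        \<comment> \<open>A shifted window of the same length sticks out of the window at r: with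
          its first index if s < r, with its last one otherwise.\<close>
        obtain l0 where l0: "l0 < m" "s + l0 \<notin> {r..<r + m}"
        proof (cases "s < r")
          case True
          then show ?thesis using that[of 0] m by auto
        next
          case False
          then have "r + m \<le> s + (m - 1)" using m s by linarith
          then show ?thesis using that[of "m - 1"] m by simp
        qed
        have "?W s = Y (s + l0) \<omega> + (\<Sum>l\<in>{..<m} - {l0}. Y (s + l) \<omega>)"
          unfolding window_sum_def using l0 by (subst sum.remove[of _ l0]) auto
        also have "Y (s + l0) \<omega> \<le> 1 / 2"
          using \<omega>[rule_format, of "s + l0"] s l0 by (simp add: B_def split: if_split_asm)
        also have "(\<Sum>l\<in>{..<m} - {l0}. Y (s + l) \<omega>) \<le> real (card ({..<m} - {l0})) * (1 + \<delta>)"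
          using s by (intro sum_bounded_above up) auto
        also have "1 / 2 + \<dots> < real m"
          using l0 \<delta> m by (simp add: of_nat_diff algebra_simps)
        finally show ?thesis using Wr by simp
      qed
      then show "limit_rank m (\<lambda>r. Y r \<omega>) = r"
        using limit_rank_eq_iff[OF r] by blast
    qed
  qed
  finally show ?thesis .
qed

section \<open>Law of the limiting rank and convergence in distribution\<close>

context
  fixes m :: nat
  assumes m: "1 \<le> m"
begin

abbreviation "rank_event A \<equiv> {\<omega> \<in> space N. limit_rank m (\<lambda>r. Y r \<omega>) \<in> A}"

lemma sets_rank_event: "rank_event A \<in> sets N"
proof -
  have "(\<lambda>\<omega>. limit_rank m (\<lambda>r. Y r \<omega>)) \<in> N \<rightarrow>\<^sub>M count_space UNIV"
    by (rule measurable_limit_rank[OF rv])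
  from measurable_sets[OF this, of A] show ?thesis
    by (simp add: vimage_def Int_def conj_commute)
qed

text \<open>Almost surely a unique maximiser exists, so the rank is nonzero and the disjoint events
  for positive ranks exhaust the space up to a null set.\<close>

lemma prob_rank_sums: "(\<lambda>r. prob (rank_event {Suc r})) sums 1"
proof -
  have ev: "{\<omega> \<in> space N. limit_rank m (\<lambda>r. Y r \<omega>) = Suc r} \<in> sets N" for r
    using sets_rank_event[of "{Suc r}"] by simp
  then have "(\<lambda>r. prob (rank_event {Suc r})) sums prob (\<Union>r. rank_event {Suc r})"
    by (intro finite_measure_UNION) (auto simp: disjoint_family_on_def)
  moreover have "AE \<omega> in N. \<omega> \<in> (\<Union>r. rank_event {Suc r})"
    using AE_unique_max[OF m, folded limit_rank_nonzero_iff] AE_space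
    by eventually_elim (auto simp: gr0_conv_Suc)
  then have "prob (\<Union>r. rank_event {Suc r}) = 1"
    using ev by (subst prob_eq_1) auto
  ultimately show ?thesis by simp
qed

text \<open>These are partial sums of the series in \<open>prob_rank_sums\<close>; shifting n by m
  removes the truncated subtraction.\<close>

lemma prob_rank_atMost_tendsto: "(\<lambda>n. prob (rank_event {1..Suc n - m})) \<longlonglongrightarrow> 1"
proof (rule LIMSEQ_offset)
  have "prob (rank_event {1..k}) = (\<Sum>r<k. prob (rank_event {Suc r}))" for k
  proof (induction k)
    case (Suc k)
    have "rank_event {1..Suc k} = rank_event {1..k} \<union> rank_event {Suc k}" by auto
    then have "prob (rank_event {1..Suc k}) = prob (rank_event {1..k}) + prob (rank_event {Suc k})"
      using sets_rank_event[of "{1..k}"] sets_rank_event[of "{Suc k}"]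
      by (subst finite_measure_Union[symmetric]) auto
    then show ?case using Suc by simp
  qed simp
  then show "(\<lambda>n. prob (rank_event {1..Suc (n + m) - m})) \<longlonglongrightarrow> 1"
    using LIMSEQ_Suc[OF prob_rank_sums[unfolded sums_def]] by simp
qed

lemma prob_rank_Int_ge: "prob (rank_event A) + prob (rank_event I) - 1 \<le> prob (rank_event (A \<inter> I))"
proof -
  have "rank_event (A \<inter> I) = rank_event A \<inter> rank_event I"
    by blast
  moreover have "prob (rank_event A \<union> rank_event I)
      = prob (rank_event A) + prob (rank_event I) - prob (rank_event A \<inter> rank_event I)"
    by (intro measure_Un3) (simp_all only: fmeasurable_eq_sets sets_rank_event)
  moreover have "prob (rank_event A \<union> rank_event I) \<le> 1" by simp
  ultimately show ?thesis by (simp only:)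
qed

text \<open>The upper bound is the lower bound for the complement of \<open>A\<close>. If n < m, the
  interval of ranks is empty and both bounds are trivial.\<close>

lemma prob_max_spacing_rank_bounds:
  fixes A :: "nat set"
  assumes n: "n \<ge> 1" and M: "prob_space M"
    and X: "prob_space.indep_vars M (\<lambda>_. borel) X {1..n}"
      "\<And>i. i \<in> {1..n} \<Longrightarrow> distributed M lborel (X i) (exponential_density 1)"
  defines "p \<equiv> measure M {\<omega> \<in> space M. max_spacing_rank m (\<lambda>i. X i \<omega>) n \<in> A}"
  shows "prob (rank_event A) + prob (rank_event {1..Suc n - m}) - 1 \<le> p"
    and "p \<le> prob (rank_event A) + (1 - prob (rank_event {1..Suc n - m}))"
proof -
  let ?G = "\<lambda>\<omega>. max_spacing_rank m (\<lambda>i. X i \<omega>) n"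
  let ?I = "{1..Suc n - m}"
  have G: "?G \<in> M \<rightarrow>\<^sub>M count_space UNIV"
    using distributed_measurable[OF X(2)] by (intro measurable_max_spacing_rank) auto
  have ge: "prob (rank_event B) + prob (rank_event ?I) - 1 \<le> measure M {\<omega> \<in> space M. ?G \<omega> \<in> B}" for B
    using prob_rank_Int_ge[of B ?I] prob_limit_rank_le[OF m n M prob_space_axioms X indep law, of B]
    by linarith
  have "{\<omega> \<in> space M. ?G \<omega> \<in> A} \<in> sets M"
    using measurable_sets[OF G, of A] by (simp add: vimage_def Int_def conj_commute)
  moreover have "{\<omega> \<in> space M. ?G \<omega> \<in> - A} = space M - {\<omega> \<in> space M. ?G \<omega> \<in> A}"
    by blast
  ultimately have "measure M {\<omega> \<in> space M. ?G \<omega> \<in> - A} = 1 - p"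
    unfolding p_def by (simp only: prob_space.prob_compl[OF M])
  moreover have "rank_event (- A) = space N - rank_event A"
    by blast
  then have "prob (rank_event (- A)) = 1 - prob (rank_event A)"
    by (simp only: prob_compl[OF sets_rank_event])
  ultimately show "prob (rank_event A) + prob (rank_event ?I) - 1 \<le> p"
    and "p \<le> prob (rank_event A) + (1 - prob (rank_event ?I))"
    using ge[of A] ge[of "- A"] unfolding p_def by linarith+
qed

text \<open>The bounds hold for every set of ranks, so the distribution functions converge at every
  point x, continuity point or not.\<close>

lemma weak_conv_max_spacing_rank:
  assumes M: "\<And>n. n \<ge> 1 \<Longrightarrow> prob_space (M n)"
    and indepX: "\<And>n. n \<ge> 1 \<Longrightarrow> prob_space.indep_vars (M n) (\<lambda>_. borel) (X n) {1..n}"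
    and X: "\<And>n i. n \<ge> 1 \<Longrightarrow> i \<in> {1..n} \<Longrightarrow> distributed (M n) lborel (X n i) (exponential_density 1)"
  shows "weak_conv_m
      (\<lambda>n. distr (M n) borel (\<lambda>\<omega>. real (max_spacing_rank m (\<lambda>i. X n i \<omega>) n)))
      (distr N borel (\<lambda>\<omega>. real (limit_rank m (\<lambda>r. Y r \<omega>))))"
  unfolding weak_conv_m_def weak_conv_def
proof (intro allI impI)
  fix x
  define A where "A = {k :: nat. real k \<le> x}"
  have cdfN: "cdf (distr N borel (\<lambda>\<omega>. real (limit_rank m (\<lambda>r. Y r \<omega>)))) x = prob (rank_event A)"
    unfolding cdf_def A_def
    by (subst measure_distr)
      (auto intro!: measurable_compose[OF measurable_limit_rank[OF rv]] arg_cong[where f = prob])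
  let ?F = "\<lambda>n. cdf (distr (M n) borel (\<lambda>\<omega>. real (max_spacing_rank m (\<lambda>i. X n i \<omega>) n))) x"
  have F: "?F n = measure (M n) {\<omega> \<in> space (M n). max_spacing_rank m (\<lambda>i. X n i \<omega>) n \<in> A}"
    if "n \<ge> 1" for n
  proof -
    have G: "(\<lambda>\<omega>. max_spacing_rank m (\<lambda>i. X n i \<omega>) n) \<in> M n \<rightarrow>\<^sub>M count_space UNIV"
      using distributed_measurable[OF X[OF that]] by (intro measurable_max_spacing_rank) auto
    show ?thesis unfolding cdf_def A_def
      by (subst measure_distr) (auto intro!: measurable_compose[OF G] arg_cong[where f = "measure (M n)"])
  qed
  have "?F \<longlonglongrightarrow> prob (rank_event A)"
  proof (rule tendsto_sandwich)
    show "(\<lambda>n. prob (rank_event A) + prob (rank_event {1..Suc n - m}) - 1) \<longlonglongrightarrow> prob (rank_event A)"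
      using tendsto_diff[OF tendsto_add[OF tendsto_const prob_rank_atMost_tendsto] tendsto_const[of 1],
          of "prob (rank_event A)"] by simp
    show "(\<lambda>n. prob (rank_event A) + (1 - prob (rank_event {1..Suc n - m}))) \<longlonglongrightarrow> prob (rank_event A)"
      using tendsto_add[OF tendsto_const tendsto_diff[OF tendsto_const[of 1] prob_rank_atMost_tendsto],
          of "prob (rank_event A)"] by simp
    \<comment> \<open>The bounds are asserted only eventually, because nothing is assumed about
      \<open>M 0\<close>.\<close>
    show "\<forall>\<^sub>F n in sequentially. prob (rank_event A) + prob (rank_event {1..Suc n - m}) - 1 \<le> ?F n"
      using eventually_ge_at_top[of 1]
    proof eventually_elim
      case (elim n)
      show ?case
        unfolding F[OF elim] by (rule prob_max_spacing_rank_bounds(1)[OF elim M[OF elim] indepX[OF elim] X[OF elim]])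
    qed
    show "\<forall>\<^sub>F n in sequentially. ?F n \<le> prob (rank_event A) + (1 - prob (rank_event {1..Suc n - m}))"
      using eventually_ge_at_top[of 1]
    proof eventually_elim
      case (elim n)
      show ?case
        unfolding F[OF elim] by (rule prob_max_spacing_rank_bounds(2)[OF elim M[OF elim] indepX[OF elim] X[OF elim]])
    qed
  qed
  then show "?F \<longlonglongrightarrow> cdf (distr N borel (\<lambda>\<omega>. real (limit_rank m (\<lambda>r. Y r \<omega>)))) x"
    unfolding cdfN .
qed

end

end

theorem theorem7p1:
  fixes m :: nat
    and M :: "nat \<Rightarrow> 'a measure" and X :: "nat \<Rightarrow> nat \<Rightarrow> 'a \<Rightarrow> real"
    and N :: "'b measure" and Y :: "nat \<Rightarrow> 'b \<Rightarrow> real"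
    and R :: "'b \<Rightarrow> nat" and q :: "nat \<Rightarrow> real"
  assumes "m \<ge> 1"
    and "\<And>n. n \<ge> 1 \<Longrightarrow> prob_space (M n)"
    and "\<And>n. n \<ge> 1 \<Longrightarrow> prob_space.indep_vars (M n) (\<lambda>_. borel) (X n) {1..n}"
    and "\<And>n i. n \<ge> 1 \<Longrightarrow> i \<in> {1..n} \<Longrightarrow> distributed (M n) lborel (X n i) (exponential_density 1)"
    and "prob_space N"
    and "prob_space.indep_vars N (\<lambda>_. borel) Y {1..}"
    and "\<And>r. r \<ge> 1 \<Longrightarrow> distributed N lborel (Y r) (exponential_density (real r))"
  defines "R \<equiv> \<lambda>\<omega>. limit_rank m (\<lambda>r. Y r \<omega>)"
    and "q \<equiv> \<lambda>r. measure N {\<omega> \<in> space N. R \<omega> = r}"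
  shows "(AE \<omega> in N. \<exists>!r. is_arg_max (window_sum m (\<lambda>r. Y r \<omega>)) (\<lambda>r. r \<in> {1..}) r)
    \<and> R \<in> measurable N (count_space UNIV)
    \<and> weak_conv_m
        (\<lambda>n. distr (M n) borel (\<lambda>\<omega>. real (max_spacing_rank m (\<lambda>i. X n i \<omega>) n)))
        (distr N borel (\<lambda>\<omega>. real (R \<omega>)))
    \<and> (\<forall>r\<ge>1. q r > 0)
    \<and> (\<lambda>r. q (Suc r)) sums 1"
proof -
  have E: "exponential_sequence N Y"
    using assms(5,6,7) by (intro exponential_sequence.intro exponential_sequence_axioms.intro)
  note m = assms(1)
  have "R \<in> N \<rightarrow>\<^sub>M count_space UNIV"
    unfolding R_def by (rule measurable_limit_rank[OF exponential_sequence.rv[OF E]])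
  moreover have "\<forall>r\<ge>1. q r > 0"
    unfolding q_def R_def using exponential_sequence.prob_limit_rank_pos[OF E m] by blast
  moreover have "(\<lambda>r. q (Suc r)) sums 1"
    unfolding q_def R_def using exponential_sequence.prob_rank_sums[OF E m] by simp
  ultimately show ?thesis
    using exponential_sequence.AE_unique_max[OF E m]
      exponential_sequence.weak_conv_max_spacing_rank[OF E m assms(2-4)]
    unfolding R_def by blast
qed

end
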